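(* Let $n$ be a positive integer, let $K_n$ be the complete graph on $V=\{1,\dots,n\}$, and let $\tau$ be a tree with $n'\le n$ vertices, realized as a subtree of $K_n$ (its vertices labelled by elements of $V$). Seeded-Tree$(n,\tau)$: run Wilson's algorithm on $K_n$ with initial condition $\tau$ to obtain a spanning tree $T$, then apply a uniformly random permutation of $V$ to the labels of $T$, and output the resulting tree $T^*$. Then for every spanning tree $t$ of $K_n$, $\mathbb P(T^*=t)$ is proportional to the number of subtrees of $t$ that are isomorphic to $\tau$, and the expected running time of Seeded-Tree$(n,\tau)$ is $O(n)$.
   Context: Wilson's algorithm with initial condition a tree $\tau$: set $V_X=V(\tau)$, $E_X=E(\tau)$; while $V_X\ne V$, choose $v\in V\setminus V_X$ uniformly at random, run a simple random walk on $K_n$ from $v$ until it first hits $V_X$, and add the vertices and edges of its chronological loop-erasure to $V_X,E_X$; output $(V_X,E_X)$. *)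

theory Defs
  imports "HOL-Probability.Probability" "HOL-Combinatorics.Permutations"
begin

section \<open>Finite simple graphs and trees\<close>

type_synonym 'a ugraph = "'a set \<times> 'a set set"

abbreviation verts :: "'a ugraph \<Rightarrow> 'a set" where "verts \<equiv> fst"
abbreviation edges :: "'a ugraph \<Rightarrow> 'a set set" where "edges \<equiv> snd"

definition simple_graph :: "'a ugraph \<Rightarrow> bool" where
  "simple_graph G \<longleftrightarrow>
     finite (verts G) \<and> (\<forall>e\<in>edges G. e \<subseteq> verts G \<and> card e = 2)"

definition subgraph :: "'a ugraph \<Rightarrow> 'a ugraph \<Rightarrow> bool" where
  "subgraph H G \<longleftrightarrow> simple_graph H \<and> verts H \<subseteq> verts G \<and> edges H \<subseteq> edges G"

definition walk :: "'a ugraph \<Rightarrow> 'a list \<Rightarrow> bool" where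
  "walk G w \<longleftrightarrow> w \<noteq> [] \<and> set w \<subseteq> verts G \<and> successively (\<lambda>x y. {x, y} \<in> edges G) w"

definition connected_graph :: "'a ugraph \<Rightarrow> bool" where
  "connected_graph G \<longleftrightarrow> verts G \<noteq> {} \<and>
     (\<forall>u\<in>verts G. \<forall>v\<in>verts G. \<exists>w. walk G w \<and> hd w = u \<and> last w = v)"

definition cycle :: "'a ugraph \<Rightarrow> 'a list \<Rightarrow> bool" where
  "cycle G w \<longleftrightarrow> walk G w \<and> distinct w \<and> length w \<ge> 3 \<and> {last w, hd w} \<in> edges G"

definition is_tree :: "'a ugraph \<Rightarrow> bool" where
  "is_tree G \<longleftrightarrow> simple_graph G \<and> connected_graph G \<and> (\<nexists>w. cycle G w)"

definition subtree :: "'a ugraph \<Rightarrow> 'a ugraph \<Rightarrow> bool" where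
  "subtree H G \<longleftrightarrow> subgraph H G \<and> is_tree H"

definition spanning_tree :: "'a ugraph \<Rightarrow> 'a ugraph \<Rightarrow> bool" where
  "spanning_tree T G \<longleftrightarrow> subtree T G \<and> verts T = verts G"

definition isomorphic :: "'a ugraph \<Rightarrow> 'b ugraph \<Rightarrow> bool" where
  "isomorphic G H \<longleftrightarrow> (\<exists>f. bij_betw f (verts G) (verts H) \<and>
     (\<forall>u\<in>verts G. \<forall>v\<in>verts G. {u, v} \<in> edges G \<longleftrightarrow> {f u, f v} \<in> edges H))"

definition relabel :: "('a \<Rightarrow> 'b) \<Rightarrow> 'a ugraph \<Rightarrow> 'b ugraph" where
  "relabel f G = (f ` verts G, (\<lambda>e. f ` e) ` edges G)"

definition complete_graph :: "nat \<Rightarrow> nat ugraph" where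
  "complete_graph n = ({1..n}, {e. e \<subseteq> {1..n} \<and> card e = 2})"


section \<open>Random walk and loop-erasure\<close>

text \<open>
  Simple random walk from \<open>x\<close>, stopped on first hitting \<open>S\<close>. The result is the list
  of all visited vertices, starting point and hitting point included. Walks that never hit
  \<open>S\<close> contribute the mass that the subprobability distribution is missing.
\<close>
partial_function (spmf) random_walk ::
  "'a ugraph \<Rightarrow> 'a set \<Rightarrow> 'a \<Rightarrow> 'a list spmf" where
  "random_walk G S x =
     (if x \<in> S then return_spmf [x]
      else bind_spmf (spmf_of_set {y. {x, y} \<in> edges G})
             (\<lambda>y. map_spmf ((#) x) (random_walk G S y)))"

text \<open>
  In \<open>chron_erase p w\<close>, the stack \<open>p\<close> is the loop-erasure of the part of the walk
  already read, most recent vertex first, and \<open>w\<close> is the part still to be read. A return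
  to a vertex \<open>x\<close> of \<open>p\<close> closes a loop, which is erased by popping everything
  above \<open>x\<close>.
\<close>
fun chron_erase :: "'a list \<Rightarrow> 'a list \<Rightarrow> 'a list" where
  "chron_erase p [] = rev p"
| "chron_erase p (x # w) =
     chron_erase (if x \<in> set p then dropWhile (\<lambda>y. y \<noteq> x) p else x # p) w"

definition loop_erasure :: "'a list \<Rightarrow> 'a list" where
  "loop_erasure w = chron_erase [] w"

fun path_edges :: "'a list \<Rightarrow> 'a set set" where
  "path_edges (x # y # w) = insert {x, y} (path_edges (y # w))"
| "path_edges _ = {}"

definition add_path :: "'a list \<Rightarrow> 'a ugraph \<Rightarrow> 'a ugraph" where
  "add_path p X = (verts X \<union> set p, edges X \<union> path_edges p)"


section \<open>Running time\<close>

text \<open>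
  Running time is the number of elementary operations on a unit-cost random access machine
  that can draw a uniform element of an array range in one operation. Vertex sets and the
  loop-erasure stack carry mark arrays, so that membership tests cost one operation, and the
  vertices outside the current tree are kept in an array with constant-time deletion, so
  that drawing one of them uniformly costs one operation.
\<close>

text \<open>One membership test per vertex read, and one operation per push and per pop.\<close>
fun T_chron_erase :: "'a list \<Rightarrow> 'a list \<Rightarrow> nat" where
  "T_chron_erase p [] = 0"
| "T_chron_erase p (x # w) =
     (if x \<in> set p
      then 1 + length (takeWhile (\<lambda>y. y \<noteq> x) p) + T_chron_erase (dropWhile (\<lambda>y. y \<noteq> x) p) w
      else 2 + T_chron_erase (x # p) w)"

text \<open>One test for having hit the target per vertex visited, and one draw per step.\<close>
definition T_random_walk :: "'a list \<Rightarrow> nat" where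
  "T_random_walk w = length w + (length w - 1)"

text \<open>One operation per vertex and per edge of the path.\<close>
definition T_add_path :: "'a list \<Rightarrow> nat" where
  "T_add_path p = length p + (length p - 1)"

text \<open>One pass of the main loop: loop test, draw of the starting vertex, then the above.\<close>
definition T_branch :: "'a list \<Rightarrow> nat" where
  "T_branch w = 2 + T_random_walk w + T_chron_erase [] w + T_add_path (loop_erasure w)"


section \<open>The algorithms\<close>

text \<open>Results are pairs of the output and the running time; \<open>k\<close> is the time already spent.\<close>

partial_function (spmf) wilson_loop ::
  "'a ugraph \<Rightarrow> 'a ugraph \<Rightarrow> nat \<Rightarrow> ('a ugraph \<times> nat) spmf" where
  "wilson_loop G X k =
     (if verts X = verts G then return_spmf (X, k + 1)
      else bind_spmf (spmf_of_set (verts G - verts X))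
             (\<lambda>v. bind_spmf (random_walk G (verts X) v)
               (\<lambda>w. wilson_loop G (add_path (loop_erasure w) X) (k + T_branch w))))"

text \<open>The initial cost is that of setting up the arrays and reading the initial tree.\<close>
definition wilson :: "'a ugraph \<Rightarrow> 'a ugraph \<Rightarrow> ('a ugraph \<times> nat) spmf" where
  "wilson G \<tau> =
     wilson_loop G \<tau> (card (verts G) + card (verts \<tau>) + card (edges \<tau>))"

text \<open>
  A uniform permutation costs \<open>2 * n\<close> operations (a draw and a swap per entry), and
  relabelling costs one operation per vertex and per edge.
\<close>
definition seeded_tree :: "nat \<Rightarrow> nat ugraph \<Rightarrow> (nat ugraph \<times> nat) spmf" where
  "seeded_tree n \<tau> =
     bind_spmf (wilson (complete_graph n) \<tau>)
       (\<lambda>(T, k). bind_spmf (spmf_of_set {\<pi>. \<pi> permutes {1..n}})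
         (\<lambda>\<pi>. return_spmf (relabel \<pi> T, k + 2 * n + card (verts T) + card (edges T))))"

definition seeded_tree_output :: "nat \<Rightarrow> nat ugraph \<Rightarrow> nat ugraph spmf" where
  "seeded_tree_output n \<tau> = map_spmf fst (seeded_tree n \<tau>)"

text \<open>Nontermination counts as infinite running time.\<close>
definition expected_time :: "('b \<times> nat) spmf \<Rightarrow> ennreal" where
  "expected_time p =
     (\<integral>\<^sup>+ r. (case r of None \<Rightarrow> \<infinity> | Some (_, k) \<Rightarrow> of_nat k) \<partial>measure_pmf p)"

end

theory Submission
  imports Defs
begin

text \<open>
  On \<open>K\<^sub>n\<close> the loop-erasure of the walk from \<open>v\<close> to a set of \<open>s\<close> vertices equals a given path
  with \<open>D\<close> edges with probability \<open>(s + D) / (s n\<^sup>D)\<close>. This is obtained by following the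
  loop-erasure stack as a Markov chain: functions on stacks that are harmonic for the walk killed
  at the set are determined by their boundary values, and the solution is explicit. The product of
  these probabilities over the branches telescopes, and every spanning tree \<open>T\<close> that contains the
  current tree contains exactly one admissible branch from \<open>v\<close>, so Wilson's algorithm outputs each
  spanning tree containing \<open>\<tau>\<close> with the same probability. Hence \<open>T\<^sup>* = t\<close> has probability
  proportional to the number of permutations mapping \<open>\<tau>\<close> into \<open>t\<close>, and each copy of \<open>\<tau>\<close> in \<open>t\<close> is
  the image of \<open>\<tau>\<close> under the same number of permutations.

  For the running time, the potential \<open>(n - s) (1 + 1/s)\<close> of a tree with \<open>s\<close> vertices decreases
  on average by at least the expected length of the walk in each branch, and it is at most \<open>2 n\<close>.
\<close>

section \<open>Paths and trees\<close>

lemma walk_Cons_Cons: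
  "walk G (x # y # w) \<longleftrightarrow> x \<in> verts G \<and> {x, y} \<in> edges G \<and> walk G (y # w)"
  by (auto simp: walk_def)

lemma walk_singleton: "walk G [x] \<longleftrightarrow> x \<in> verts G"
  by (auto simp: walk_def)

lemma walk_append:
  assumes "xs \<noteq> []" "ys \<noteq> []"
  shows "walk G (xs @ ys) \<longleftrightarrow> walk G xs \<and> walk G ys \<and> {last xs, hd ys} \<in> edges G"
  using assms by (auto simp: walk_def successively_append_iff)

lemma walk_rev: "walk G (rev w) \<longleftrightarrow> walk G w"
  by (auto simp: walk_def successively_rev insert_commute)

lemma walk_join:
  assumes "walk G u" "walk G w" "last u = hd w"
  shows "walk G (u @ tl w)"
proof (cases "tl w")
  case Nil
  then show ?thesis using assms(1) by simp
next
  case (Cons y ys)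
  then have "w = hd w # y # ys" using assms(2) by (cases w) (auto simp: walk_def)
  with assms have "{last u, y} \<in> edges G" "walk G (y # ys)"
    by (metis walk_Cons_Cons)+
  moreover have "u \<noteq> []" using assms(1) by (auto simp: walk_def)
  ultimately show ?thesis using assms(1) Cons by (simp add: walk_append)
qed

lemma last_append_tl:
  assumes "u \<noteq> []" "w \<noteq> []" "last u = hd w"
  shows "last (u @ tl w) = last w"
  using assms by (cases w) auto

lemma walk_mono:
  assumes "walk H w" "subgraph H G"
  shows "walk G w"
  using assms unfolding walk_def subgraph_def by (auto elim: successively_mono)

text \<open>Cutting out the stretch between two occurrences of a vertex shortens the walk and keeps
  its ends.\<close>

lemma walk_imp_path:
  assumes "walk G w"
  shows "\<exists>p. walk G p \<and> distinct p \<and> hd p = hd w \<and> last p = last w"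
  using assms
proof (induction "length w" arbitrary: w rule: less_induct)
  case less
  show ?case
  proof (cases "distinct w")
    case True
    then show ?thesis using less.prems by blast
  next
    case False
    then obtain a b c x where w: "w = a @ [x] @ b @ [x] @ c"
      using not_distinct_decomp by blast
    let ?w = "(a @ [x]) @ c"
    have "walk G (a @ [x])" "walk G (x # c)"
      using less.prems walk_append[of "a @ [x]" "b @ [x] @ c" G] walk_append[of "a @ [x] @ b" "x # c" G]
      by (auto simp: w)
    then have "walk G ?w" using walk_join[of G "a @ [x]" "x # c"] by simp
    moreover have "length ?w < length w" "hd ?w = hd w" "last ?w = last w"
      by (auto simp: w hd_append)
    ultimately show ?thesis using less.hyps[of ?w] by metis
  qed
qed

text \<open>Where two paths with the same ends first part, following one until it meets the other
  again and returning along the other closes a cycle.\<close>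

lemma acyclic_path_unique:
  assumes "\<nexists>w. cycle G w" "walk G p" "walk G q" "distinct p" "distinct q"
    "hd p = hd q" "last p = last q"
  shows "p = q"
  using assms(2-)
proof (induction p arbitrary: q)
  case Nil
  then show ?case by (simp add: walk_def)
next
  case (Cons x p)
  obtain q' where q: "q = x # q'" using Cons.prems by (cases q) (auto simp: walk_def)
  show ?case
  proof (cases p)
    case Nil
    then show ?thesis using Cons.prems q by (cases q') (auto split: if_splits)
  next
    case p: (Cons y p')
    have "q' \<noteq> []"
    proof
      assume "q' = []"
      then have "last p = x" using Cons.prems(6) p q by simp
      then show False using Cons.prems(3) p by (metis distinct.simps(2) last_in_set list.distinct(1))
    qed
    then obtain z q'' where q': "q' = z # q''" by (cases q') auto
    show ?thesis
    proof (cases "y = z")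
      case True
      then show ?thesis using Cons.IH[of q'] Cons.prems by (auto simp: p q q' walk_Cons_Cons)
    next
      case False
      have "\<exists>c\<in>set p. c \<in> set q'"
        using Cons.prems(6) p q q' by (metis last_ConsR last_in_set list.distinct(1))
      \<comment> \<open>Taking the first vertex of \<open>p\<close> on \<open>q'\<close> keeps
        \<open>a\<close> off \<open>q'\<close>, so that \<open>?C\<close> repeats no vertex.\<close>
      then obtain a c b where a: "p = a @ c # b" "c \<in> set q'" "\<forall>d\<in>set a. d \<notin> set q'"
        using split_list_first_prop[of p "\<lambda>c. c \<in> set q'"] by blast
      obtain a' b' where a': "q' = a' @ c # b'" using split_list a(2) by metis
      let ?C = "(x # a) @ (c # rev a')"
      have lc: "last ?C = z" using q' a' by (cases a') auto
      have "walk G (x # a @ [c])" "walk G (a' @ [c])"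
        using Cons.prems(1) Cons.prems(2)
          walk_append[of "x # a @ [c]" b G] walk_append[of "[x]" "a' @ c # b'" G]
          walk_append[of "a' @ [c]" b' G]
        unfolding a(1) q a' by (cases b; cases b'; auto)+
      then have "walk G ?C"
        using walk_rev[of G "a' @ [c]"] walk_join[of G "x # a @ [c]" "c # rev a'"] by simp
      moreover have "distinct ?C" using Cons.prems(3,4) a a' q by auto
      \<comment> \<open>\<open>a\<close> and \<open>a'\<close> cannot both be empty, since then
        \<open>c\<close> would be both \<open>y\<close> and \<open>z\<close>.\<close>
      moreover have "length ?C \<ge> 3"
        using False p q' a a' by (cases a; cases a') auto
      moreover have "{last ?C, hd ?C} \<in> edges G"
        using lc Cons.prems(2) q q' by (simp add: walk_Cons_Cons insert_commute)
      ultimately have "cycle G ?C" by (simp add: cycle_def)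
      then show ?thesis using assms(1) by blast
    qed
  qed
qed

section \<open>Growing trees by leaves and paths\<close>

lemma connected_graphI:
  assumes "r \<in> verts G" "\<And>v. v \<in> verts G \<Longrightarrow> \<exists>w. walk G w \<and> hd w = v \<and> last w = r"
  shows "connected_graph G"
  unfolding connected_graph_def
proof (intro conjI ballI)
  show "verts G \<noteq> {}" using assms(1) by blast
next
  fix u v assume "u \<in> verts G" "v \<in> verts G"
  then obtain p q where p: "walk G p" "hd p = u" "last p = r" and q: "walk G q" "hd q = v" "last q = r"
    using assms(2) by meson
  have ne: "p \<noteq> []" "q \<noteq> []" using p q by (auto simp: walk_def)
  then have "walk G (p @ tl (rev q)) \<and> hd (p @ tl (rev q)) = u \<and> last (p @ tl (rev q)) = v"
    using p q walk_join[of G p "rev q"] last_append_tl[of p "rev q"]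
    by (simp add: walk_rev hd_rev last_rev)
  then show "\<exists>w. walk G w \<and> hd w = u \<and> last w = v" by blast
qed

lemma connected_path:
  assumes "connected_graph G" "u \<in> verts G" "v \<in> verts G"
  obtains p where "walk G p" "distinct p" "hd p = u" "last p = v"
  using assms walk_imp_path unfolding connected_graph_def by metis

lemma cycle_rotate: "cycle G (a @ b) \<Longrightarrow> cycle G (b @ a)"
proof (induction a arbitrary: b)
  case (Cons x a)
  have c: "cycle G (x # a @ b)" using Cons.prems by simp
  then obtain y ys where y: "a @ b = y # ys" by (cases "a @ b") (auto simp: cycle_def)
  have "cycle G ((a @ b) @ [x])"
    using c walk_append[of "a @ b" "[x]" G] unfolding cycle_def y
    by (auto simp: walk_Cons_Cons walk_singleton insert_commute)
  then show ?case using Cons.IH[of "b @ [x]"] by simp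
qed simp

text \<open>A cycle through the new vertex \<open>x\<close> would use two different edges at
  \<open>x\<close>, but \<open>{x, y}\<close> is the only one.\<close>

lemma is_tree_add_leaf:
  assumes "is_tree X" "x \<notin> verts X" "y \<in> verts X"
  shows "is_tree (insert x (verts X), insert {x, y} (edges X))" (is "is_tree ?Y")
proof -
  have xy: "x \<noteq> y" using assms by blast
  have sX: "simple_graph X" and cX: "connected_graph X" and aX: "\<nexists>w. cycle X w"
    using assms(1) by (auto simp: is_tree_def)
  have nox: "e \<in> edges X \<Longrightarrow> x \<notin> e" for e using sX assms(2) by (auto simp: simple_graph_def)
  have sY: "simple_graph ?Y" using sX assms(3) xy by (auto simp: simple_graph_def card_insert_if)
  have sub: "subgraph X ?Y" using sX by (auto simp: subgraph_def)
  have "connected_graph ?Y"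
  proof (rule connected_graphI)
    show "y \<in> verts ?Y" using assms(3) by simp
    fix v assume v: "v \<in> verts ?Y"
    show "\<exists>w. walk ?Y w \<and> hd w = v \<and> last w = y"
    proof (cases "v = x")
      case True
      then have "walk ?Y [x, y]" using assms(3) by (auto simp: walk_def)
      then show ?thesis using True by force
    next
      case False
      then show ?thesis using v cX assms(3) walk_mono[OF _ sub]
        unfolding connected_graph_def by fastforce
    qed
  qed
  moreover have "\<not> cycle ?Y w" for w
  proof
    assume c: "cycle ?Y w"
    show False
    proof (cases "x \<in> set w")
      case True
      then obtain a b where "w = a @ x # b" using split_list by metis
      then have c': "cycle ?Y (x # b @ a)" using c cycle_rotate[of ?Y a "x # b"] by simp
      then obtain z zs where z: "b @ a = z # zs" by (cases "b @ a") (auto simp: cycle_def)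
      have zs: "zs \<noteq> []" using c' unfolding z by (auto simp: cycle_def)
      have "{x, z} \<in> edges ?Y" "{last zs, x} \<in> edges ?Y" "z \<noteq> last zs"
        using c' zs unfolding z by (auto simp: cycle_def walk_Cons_Cons)
      then have "{x, z} = {x, y}" "{last zs, x} = {x, y}" using nox by auto
      then show False using \<open>z \<noteq> last zs\<close> by (auto simp: doubleton_eq_iff)
    next
      case False
      have "hd w \<in> set w" using c by (auto simp: cycle_def walk_def)
      then have "x \<noteq> hd w" "x \<noteq> last w"
        using False c by (auto simp: cycle_def walk_def)
      then have "{last w, hd w} \<in> edges X"
        using c by (auto simp: cycle_def doubleton_eq_iff)
      moreover have "successively (\<lambda>u v. {u, v} \<in> edges X) w"
        using c False unfolding cycle_def walk_def
        by (auto elim!: successively_mono simp: doubleton_eq_iff)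
      moreover have "set w \<subseteq> verts X" using c False by (auto simp: cycle_def walk_def)
      ultimately have "cycle X w" using c by (auto simp: cycle_def walk_def)
      then show False using aX by blast
    qed
  qed
  ultimately show ?thesis using sY by (auto simp: is_tree_def)
qed

text \<open>The tail of \<open>p\<close> is hung on \<open>X\<close> first, by its last vertex; the
  head is then a leaf.\<close>

lemma is_tree_add_path:
  assumes "is_tree X" "distinct p" "p \<noteq> []" "last p \<in> verts X" "set (butlast p) \<inter> verts X = {}"
  shows "is_tree (add_path p X)"
  using assms(2-)
proof (induction p)
  case (Cons x p)
  show ?case
  proof (cases p)
    case Nil
    then show ?thesis using Cons.prems assms(1) by (simp add: add_path_def insert_absorb)
  next
    case (Cons y q)
    then have "is_tree (add_path p X)" using Cons.IH Cons.prems by auto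
    from is_tree_add_leaf[OF this, of x y] show ?thesis
      using Cons Cons.prems by (auto simp: add_path_def)
  qed
qed simp

section \<open>Branches attached to a subtree\<close>

lemma walk_iff_path_edges:
  "walk G p \<longleftrightarrow> p \<noteq> [] \<and> set p \<subseteq> verts G \<and> path_edges p \<subseteq> edges G"
proof -
  have "successively (\<lambda>x y. {x, y} \<in> edges G) p \<longleftrightarrow> path_edges p \<subseteq> edges G"
    by (induction p rule: path_edges.induct) auto
  then show ?thesis by (auto simp: walk_def)
qed

lemma subgraph_add_path:
  assumes "subgraph X T" "simple_graph (add_path p X)" "p \<noteq> []"
  shows "subgraph (add_path p X) T \<longleftrightarrow> walk T p"
  using assms by (auto simp: subgraph_def walk_iff_path_edges add_path_def)

text \<open>These are the branches that Wilson's algorithm may add from \<open>v\<close> to a tree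
  with vertex set \<open>S\<close>. No graph is fixed; which edges are allowed is a separate
  condition \<open>walk T p\<close>.\<close>

definition path_into :: "'a set \<Rightarrow> 'a \<Rightarrow> 'a list \<Rightarrow> bool" where
  "path_into S v p \<longleftrightarrow>
     distinct p \<and> p \<noteq> [] \<and> hd p = v \<and> last p \<in> S \<and> set (butlast p) \<inter> S = {}"

text \<open>Cut a path from \<open>v\<close> to some vertex of \<open>S\<close> at its first visit
  to \<open>S\<close>.\<close>

lemma path_into_exists:
  assumes "connected_graph T" "v \<in> verts T" "S \<inter> verts T \<noteq> {}"
  shows "\<exists>p. walk T p \<and> path_into S v p"
proof -
  obtain r where r: "r \<in> S" "r \<in> verts T" using assms by blast
  obtain p where p: "walk T p" "distinct p" "hd p = v" "last p = r"
    using connected_path assms r by metis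
  have "p \<noteq> []" using p by (auto simp: walk_def)
  then have "\<exists>c\<in>set p. c \<in> S" using p r last_in_set by metis
  then obtain a c b where a: "p = a @ c # b" "c \<in> S" "\<forall>d\<in>set a. d \<notin> S"
    using split_list_first_prop[of p "\<lambda>c. c \<in> S"] by blast
  have "walk T (a @ [c])" using p walk_append[of "a @ [c]" b T] by (cases b) (auto simp: a)
  moreover have "path_into S v (a @ [c])" using p a by (cases a) (auto simp: path_into_def)
  ultimately show ?thesis by blast
qed

text \<open>Extend \<open>p\<close> inside \<open>X\<close> to the end of \<open>q\<close>. The
  result is a path of \<open>T\<close> with the ends of \<open>q\<close>, hence equal to
  \<open>q\<close>; since \<open>q\<close> meets \<open>X\<close> only in its last vertex, the
  extension is trivial.\<close>

lemma path_into_unique: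
  assumes "\<nexists>w. cycle T w" "subgraph X T" "connected_graph X"
    and p: "walk T p" "path_into (verts X) v p"
    and q: "walk T q" "path_into (verts X) v q"
  shows "p = q"
proof -
  obtain d where d: "walk X d" "distinct d" "hd d = last p" "last d = last q"
    using connected_path[OF assms(3), of "last p" "last q"] p q by (auto simp: path_into_def)
  obtain d' where d': "d = last p # d'" using d by (cases d) (auto simp: walk_def)
  have dX: "set d \<subseteq> verts X" using d by (auto simp: walk_def)
  have pne: "p \<noteq> []" "q \<noteq> []" using p q by (auto simp: path_into_def)
  have walk: "walk T (p @ d')"
    using walk_join[OF p(1) walk_mono[OF d(1) assms(2)]] d(3) d' by simp
  have pb: "p = butlast p @ [last p]" using pne by simp
  have "set p \<inter> set d' = {}"
  proof -
    have "set p = insert (last p) (set (butlast p))" by (subst pb) simp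
    then show ?thesis using d(2) d' p(2) dX by (auto simp: path_into_def)
  qed
  then have "distinct (p @ d')" using d d' p by (auto simp: path_into_def)
  moreover have "last (p @ d') = last q" using d d' by (cases d') auto
  moreover have "hd (p @ d') = hd q" using p q pne by (simp add: path_into_def)
  ultimately have eq: "p @ d' = q"
    using acyclic_path_unique[OF assms(1) walk q(1)] q by (simp add: path_into_def)
  have "d' = []"
  proof (rule ccontr)
    assume "d' \<noteq> []"
    then have "last p \<in> set (butlast q)" using eq pne by (auto simp: butlast_append)
    then show False using p q by (auto simp: path_into_def)
  qed
  then show ?thesis using eq by simp
qed

text \<open>For an edge of \<open>T\<close>, the path in \<open>X\<close> between its ends is also a
  path in \<open>T\<close>, so by uniqueness it is the edge itself.\<close>

lemma spanning_subtree_eq: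
  assumes "is_tree X" "is_tree T" "subgraph X T" "verts X = verts T"
  shows "X = T"
proof -
  have "e \<in> edges X" if e: "e \<in> edges T" for e
  proof -
    have "e \<subseteq> verts T" "card e = 2" using assms(2) e by (auto simp: is_tree_def simple_graph_def)
    then obtain x y where xy: "e = {x, y}" "x \<noteq> y" "x \<in> verts T" "y \<in> verts T"
      by (auto simp: card_2_iff)
    obtain p where p: "walk X p" "distinct p" "hd p = x" "last p = y"
      using connected_path[of X x y] assms xy by (auto simp: is_tree_def)
    have "walk T [x, y]" using e xy by (auto simp: walk_def)
    then have "p = [x, y]"
      using acyclic_path_unique[of T p "[x, y]"] p walk_mono[OF p(1) assms(3)] assms(2) xy
      by (auto simp: is_tree_def)
    then show ?thesis using p xy by (simp add: walk_def)
  qed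
  then show ?thesis using assms(3,4) by (auto simp: subgraph_def prod_eq_iff)
qed

lemma card_edges_le_card_verts:
  assumes "is_tree G"
  shows "card (edges G) \<le> card (verts G)"
proof -
  have s: "simple_graph G" and c: "connected_graph G" and a: "\<nexists>w. cycle G w"
    using assms by (auto simp: is_tree_def)
  obtain r where r: "r \<in> verts G" using c by (auto simp: connected_graph_def)
  have "\<forall>v\<in>verts G. \<exists>p. walk G p \<and> distinct p \<and> hd p = v \<and> last p = r"
    using connected_path[OF c _ r] by metis
  then obtain P where P: "\<And>v. v \<in> verts G \<Longrightarrow> walk G (P v) \<and> distinct (P v) \<and> hd (P v) = v \<and> last (P v) = r"
    by metis
  \<comment> \<open>Every edge joins a vertex to the next vertex on its path to the root \<open>r\<close>.\<close>
  have "edges G \<subseteq> (\<lambda>v. {v, P v ! 1}) ` verts G"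
  proof
    fix e assume e: "e \<in> edges G"
    then have "e \<subseteq> verts G" "card e = 2" using s by (auto simp: simple_graph_def)
    then obtain x y where xy: "e = {x, y}" "x \<noteq> y" "x \<in> verts G" "y \<in> verts G"
      by (auto simp: card_2_iff)
    obtain p where Px: "P x = x # p" using P[OF xy(3)] by (cases "P x") (auto simp: walk_def)
    \<comment> \<open>If \<open>y\<close> is off the path from \<open>x\<close> to \<open>r\<close>,
      prepending \<open>y\<close> gives the path of \<open>y\<close>, with second vertex
      \<open>x\<close>; otherwise \<open>y\<close> comes directly after \<open>x\<close>.\<close>
    show "e \<in> (\<lambda>v. {v, P v ! 1}) ` verts G"
    proof (cases "y \<in> set p")
      case False
      have "walk G (y # P x)" "distinct (y # P x)"
        using P[OF xy(3)] e xy False Px by (auto simp: walk_Cons_Cons insert_commute)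
      then have "P y = y # P x"
        using acyclic_path_unique[OF a, of "P y" "y # P x"] P[OF xy(3)] P[OF xy(4)] Px by simp
      then show ?thesis using xy Px by (intro image_eqI[of _ _ y]) auto
    next
      case True
      then obtain b d where b: "p = b @ y # d" using split_list by metis
      have "walk G (x # b @ [y])"
        using P[OF xy(3)] walk_append[of "x # b @ [y]" d G] unfolding Px b by (cases d) auto
      moreover have "walk G [x, y]" using e xy by (auto simp: walk_def)
      ultimately have "x # b @ [y] = [x, y]"
        using acyclic_path_unique[OF a, of "x # b @ [y]" "[x, y]"] P[OF xy(3)] xy
        unfolding Px b by auto
      then show ?thesis using xy Px b by (intro image_eqI[of _ _ x]) auto
    qed
  qed
  then show ?thesis using s by (meson simple_graph_def surj_card_le)
qed

section \<open>Relabelling by an injection\<close>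

lemma relabel_edge_iff:
  assumes "inj f"
  shows "{f x, f y} \<in> edges (relabel f G) \<longleftrightarrow> {x, y} \<in> edges G"
proof -
  have "{f x, f y} = f ` {x, y}" by simp
  moreover have "inj ((`) f)" using assms by (simp add: inj_def inj_image_eq_iff)
  ultimately show ?thesis using inj_image_mem_iff[of "(`) f" "{x, y}"] by (simp only: relabel_def snd_conv)
qed

lemma walk_relabel_iff:
  assumes "inj f"
  shows "walk (relabel f G) (map f w) \<longleftrightarrow> walk G w"
  using assms relabel_edge_iff[OF assms, of _ _ G]
  by (auto simp: walk_def successively_map relabel_def inj_image_mem_iff image_subset_iff)

lemma cycle_relabel_iff:
  assumes "inj f"
  shows "cycle (relabel f G) (map f w) \<longleftrightarrow> cycle G w"
  using walk_relabel_iff[OF assms, of G w] relabel_edge_iff[OF assms, of "last w" "hd w" G] assms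
  by (auto simp: cycle_def hd_map last_map distinct_map walk_def inj_on_def inj_def)

lemma simple_graph_relabel:
  assumes "inj f" "simple_graph G"
  shows "simple_graph (relabel f G)"
proof -
  have "card (f ` e) = card e" for e using assms(1) by (meson card_image inj_on_subset subset_UNIV)
  then show ?thesis using assms(2) unfolding simple_graph_def relabel_def by fastforce
qed

lemma is_tree_relabel:
  assumes "inj f" "is_tree G"
  shows "is_tree (relabel f G)"
proof -
  have s: "simple_graph G" and c: "connected_graph G" and a: "\<nexists>w. cycle G w"
    using assms by (auto simp: is_tree_def)
  have "simple_graph (relabel f G)" using assms(1) s by (rule simple_graph_relabel)
  moreover have "connected_graph (relabel f G)"
    unfolding connected_graph_def
  proof (intro conjI ballI)
    show "verts (relabel f G) \<noteq> {}" using c by (auto simp: connected_graph_def relabel_def)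
    fix u v assume "u \<in> verts (relabel f G)" "v \<in> verts (relabel f G)"
    then obtain u' v' where uv: "u = f u'" "v = f v'" "u' \<in> verts G" "v' \<in> verts G"
      by (auto simp: relabel_def)
    then obtain w where "walk G w" "hd w = u'" "last w = v'"
      using c unfolding connected_graph_def by blast
    then have "walk (relabel f G) (map f w) \<and> hd (map f w) = u \<and> last (map f w) = v"
      using walk_relabel_iff[OF assms(1), of G w] uv
      by (simp add: hd_map last_map walk_def del: successively_map)
    then show "\<exists>w. walk (relabel f G) w \<and> hd w = u \<and> last w = v" by blast
  qed
  moreover have "\<not> cycle (relabel f G) w" for w
  proof
    assume w: "cycle (relabel f G) w"
    then have "set w \<subseteq> range f" by (auto simp: cycle_def walk_def relabel_def)
    then obtain w' where "w = map f w'" by (metis ex_map_conv subset_iff rangeE)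
    then show False using w cycle_relabel_iff[OF assms(1)] a by metis
  qed
  ultimately show ?thesis by (auto simp: is_tree_def)
qed

section \<open>Random walk on the complete graph\<close>

lemma nn_integral_bind_spmf:
  "(\<integral>\<^sup>+ y. g y \<partial>measure_spmf (bind_spmf p f)) =
     (\<integral>\<^sup>+ x. \<integral>\<^sup>+ y. g y \<partial>measure_spmf (f x) \<partial>measure_spmf p)"
  unfolding measure_spmf_bind o_def
  by (rule nn_integral_bind[where B = "count_space UNIV"])
     (auto simp: space_subprob_algebra)

lemma random_walk_hit: "x \<in> S \<Longrightarrow> random_walk G S x = return_spmf [x]"
  by (subst random_walk.simps) simp

lemma random_walk_step:
  assumes "x \<in> {1..n}" "x \<notin> S"
  shows "random_walk (complete_graph n) S x =
    bind_spmf (spmf_of_set ({1..n} - {x})) (\<lambda>y. map_spmf ((#) x) (random_walk (complete_graph n) S y))"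
proof -
  have "{y. {x, y} \<in> edges (complete_graph n)} = {1..n} - {x}"
    using assms(1) by (auto simp: complete_graph_def card_insert_if)
  then show ?thesis using assms(2) by (subst random_walk.simps) simp
qed

text \<open>Outcomes are finite lists, so induction on the outcome replaces fixed-point
  induction.\<close>

lemma set_spmf_random_walk:
  assumes "w \<in> set_spmf (random_walk (complete_graph n) S x)" "x \<in> {1..n}"
  shows "w \<noteq> [] \<and> hd w = x \<and> set w \<subseteq> {1..n} \<and> last w \<in> S \<and> set (butlast w) \<inter> S = {}"
  using assms
proof (induction w arbitrary: x)
  case Nil
  then show ?case
    by (cases "x \<in> S") (auto simp: random_walk_hit random_walk_step set_bind_spmf)
next
  case (Cons z w)
  show ?case
  proof (cases "x \<in> S")
    case True
    then show ?thesis using Cons.prems by (auto simp: random_walk_hit)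
  next
    case False
    have "z = x" "\<exists>y\<in>{1..n}. w \<in> set_spmf (random_walk (complete_graph n) S y)"
      using Cons.prems random_walk_step[OF Cons.prems(2) False] by (auto simp: set_bind_spmf)
    then obtain y where "z = x" "y \<in> {1..n}" "w \<in> set_spmf (random_walk (complete_graph n) S y)"
      by blast
    then show ?thesis using Cons.IH[of y] Cons.prems(2) False by (cases w) auto
  qed
qed

text \<open>The stack is arbitrary for the sake of the induction. Popping down to a revisited vertex
  never removes the bottom \<open>last p\<close>, and the only vertex of \<open>S\<close> read is
  the final one, which is new to the stack.\<close>

lemma chron_erase_path:
  assumes "w \<noteq> []" "last w \<in> S" "set (butlast w) \<inter> S = {}" "distinct p" "set p \<inter> S = {}"
  shows "path_into S (if p = [] then hd w else last p) (chron_erase p w) \<and>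
    set (chron_erase p w) \<subseteq> set p \<union> set w"
  using assms
proof (induction p w rule: chron_erase.induct)
  case (1 p)
  then show ?case by simp
next
  case (2 p x w)
  show ?case
  proof (cases "w = []")
    case True
    then have "x \<in> S" "x \<notin> set p" using 2 by auto
    then show ?thesis using 2 True by (auto simp: path_into_def hd_append hd_rev)
  next
    case False
    let ?p = "if x \<in> set p then dropWhile (\<lambda>y. y \<noteq> x) p else x # p"
    have xS: "x \<notin> S" using 2 False by auto
    have ne: "?p \<noteq> []" by (auto simp: dropWhile_eq_Nil_conv)
    have "last ?p = (if p = [] then x else last p)"
    proof (cases "x \<in> set p")
      case True
      then have "dropWhile (\<lambda>y. y \<noteq> x) p \<noteq> []" by (auto simp: dropWhile_eq_Nil_conv)
      from last_appendR[OF this, of "takeWhile (\<lambda>y. y \<noteq> x) p"] show ?thesis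
        using True by (cases p) auto
    qed auto
    moreover have sub: "set ?p \<subseteq> insert x (set p)" by (auto dest: set_dropWhileD)
    moreover have "distinct ?p" "set ?p \<inter> S = {}"
      using 2 xS sub by auto
    ultimately show ?thesis
      using 2(1)[OF False] 2(2-) False ne by (fastforce split: if_splits)
  qed
qed

lemma loop_erasure_random_walk:
  assumes "w \<in> set_spmf (random_walk (complete_graph n) S v)" "v \<in> {1..n}"
  shows "path_into S v (loop_erasure w)" "set (loop_erasure w) \<subseteq> {1..n}"
  using set_spmf_random_walk[OF assms] chron_erase_path[of w S "[]"]
  by (auto simp: loop_erasure_def)

text \<open>Popping to a revisited \<open>y\<close> yields the same stack as pushing
  \<open>y\<close> anew on what lies below it. A return is thus a fresh arrival at a shorter stack,
  which makes the stack a Markov state.\<close>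

lemma chron_erase_return:
  assumes "y \<in> set p" "distinct p" "w \<noteq> []" "hd w = y"
  shows "chron_erase p w = chron_erase (tl (dropWhile (\<lambda>z. z \<noteq> y) p)) w"
proof -
  obtain a b where p: "p = a @ y # b" "y \<notin> set a" using assms(1) split_list_first by metis
  have "dropWhile (\<lambda>z. z \<noteq> y) p = y # b" using p by (simp add: dropWhile_append)
  moreover have "y \<notin> set b" using p assms(2) by simp
  ultimately show ?thesis using assms by (cases w) auto
qed

text \<open>The nonempty suffixes of the stack below the current vertex are the stacks that remain
  after closing a loop.\<close>

fun suffix_sum :: "('a list \<Rightarrow> 'b::comm_monoid_add) \<Rightarrow> 'a list \<Rightarrow> 'b" where
  "suffix_sum h [] = 0"
| "suffix_sum h (y # q) = h (y # q) + suffix_sum h q"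

lemma sum_dropWhile_eq_suffix_sum:
  "distinct q \<Longrightarrow> (\<Sum>y\<in>set q. g (dropWhile (\<lambda>z. z \<noteq> y) q)) = suffix_sum g q"
proof (induction q)
  case (Cons x q)
  have "(\<Sum>y\<in>set q. g (dropWhile (\<lambda>z. z \<noteq> y) (x # q))) = (\<Sum>y\<in>set q. g (dropWhile (\<lambda>z. z \<noteq> y) q))"
    using Cons.prems by (intro sum.cong) auto
  then show ?case using Cons by simp
qed simp

lemma suffix_sum_le:
  fixes e h :: "'a list \<Rightarrow> real" and M :: real
  assumes "\<And>a b. q = a @ b \<Longrightarrow> b \<noteq> [] \<Longrightarrow> \<bar>e b - h b\<bar> \<le> M"
  shows "\<bar>suffix_sum e q - suffix_sum h q\<bar> \<le> length q * M"
  using assms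
proof (induction q)
  case (Cons x q)
  have "\<bar>suffix_sum e q - suffix_sum h q\<bar> \<le> length q * M"
    by (rule Cons.IH) (use Cons.prems in \<open>metis append_Cons\<close>)
  moreover have "\<bar>e (x # q) - h (x # q)\<bar> \<le> M" using Cons.prems[of "[]"] by simp
  ultimately show ?case by (simp add: algebra_simps)
qed simp

section \<open>The stack as a Markov chain: harmonic equation and uniqueness\<close>

context
  fixes n :: nat and S :: "nat set"
  assumes S: "S \<subseteq> {1..n}" "S \<noteq> {}"
begin

definition stack :: "nat list \<Rightarrow> bool" where
  "stack p \<longleftrightarrow> distinct p \<and> set p \<subseteq> {1..n} - S"

lemma finite_stack: "finite {p. stack p}"
proof (rule finite_subset)
  show "{p. stack p} \<subseteq> {p. set p \<subseteq> {1..n} \<and> length p \<le> n}"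
  proof
    fix p assume "p \<in> {p. stack p}"
    then have "set p \<subseteq> {1..n}" "length p = card (set p)"
      by (auto simp: stack_def distinct_card)
    then show "p \<in> {p. set p \<subseteq> {1..n} \<and> length p \<le> n}" using card_mono[of "{1..n}" "set p"] by simp
  qed
  show "finite {p. set p \<subseteq> {1..n} \<and> length p \<le> n}" by (rule finite_lists_length_le) simp
qed

text \<open>Fresh vertices, \<open>S\<close> and the stack partition \<open>{1..n}\<close>; the
  additive form avoids truncated subtraction.\<close>

lemma stack_card: "stack p \<Longrightarrow> card ({1..n} - S - set p) + card S + length p = n"
proof -
  assume p: "stack p"
  have "{1..n} - S - set p = {1..n} - (S \<union> set p)" by blast
  then have "card ({1..n} - S - set p) = card {1..n} - card (S \<union> set p)"
    using p S finite_subset[OF S(1)]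
    by (simp only:) (intro card_Diff_subset; auto simp: stack_def)
  moreover have "card (S \<union> set p) = card S + length p"
    using p S finite_subset[OF S(1)] by (subst card_Un_disjoint) (auto simp: stack_def distinct_card)
  moreover have "card (S \<union> set p) \<le> card {1..n}"
    using p S by (intro card_mono) (auto simp: stack_def)
  ultimately show ?thesis by simp
qed

text \<open>\<open>q\<close> is the stack below the current vertex \<open>x\<close>: the walk's
  first entry is \<open>x\<close> itself, which \<open>chron_erase\<close> still has to
  read.\<close>

definition erasure_int :: "(nat list \<Rightarrow> real) \<Rightarrow> nat list \<Rightarrow> nat \<Rightarrow> ennreal" where
  "erasure_int f q x =
     (\<integral>\<^sup>+ w. ennreal (f (chron_erase q w)) \<partial>measure_spmf (random_walk (complete_graph n) S x))"

lemma erasure_int_hit: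
  assumes "y \<in> S" "stack p"
  shows "erasure_int f p y = ennreal (f (rev p @ [y]))"
proof -
  have "y \<notin> set p" using assms by (auto simp: stack_def)
  then show ?thesis using assms(1) unfolding erasure_int_def
    by (simp add: random_walk_hit measure_spmf_return_spmf nn_integral_return)
qed

lemma erasure_int_return:
  assumes "y \<in> set p" "stack p"
  shows "erasure_int f p y = erasure_int f (tl (dropWhile (\<lambda>z. z \<noteq> y) p)) y"
  unfolding erasure_int_def
proof (rule nn_integral_cong_AE, rule AE_measure_spmf_iff[THEN iffD2], rule ballI)
  fix w assume "w \<in> set_spmf (random_walk (complete_graph n) S y)"
  moreover have "y \<in> {1..n}" using assms by (auto simp: stack_def)
  ultimately have "w \<noteq> []" "hd w = y" using set_spmf_random_walk by blast+
  then show "ennreal (f (chron_erase p w)) = ennreal (f (chron_erase (tl (dropWhile (\<lambda>z. z \<noteq> y) p)) w))"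
    using chron_erase_return[of y p w] assms unfolding stack_def by simp
qed

lemma erasure_int_step:
  assumes "stack (x # q)"
  shows "erasure_int f q x = (\<Sum>y\<in>{1..n} - {x}. erasure_int f (x # q) y) / (of_nat (n - 1))"
proof -
  have x: "x \<in> {1..n}" "x \<notin> S" "x \<notin> set q" using assms by (auto simp: stack_def)
  have "card ({1..n} - {x}) = n - 1" using x by simp
  then show ?thesis unfolding erasure_int_def using x
    by (simp add: random_walk_step nn_integral_bind_spmf nn_integral_spmf_of_set o_def)
qed

lemma erasure_int_bound:
  assumes "\<And>r. f r \<le> B" "0 \<le> B"
  shows "erasure_int f q x \<le> ennreal B"
proof -
  have "erasure_int f q x \<le> (\<integral>\<^sup>+ w. ennreal B \<partial>measure_spmf (random_walk (complete_graph n) S x))"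
    unfolding erasure_int_def by (intro nn_integral_mono ennreal_leI assms)
  also have "\<dots> \<le> ennreal B * 1"
    unfolding nn_integral_const
    by (intro mult_left_mono measure_spmf.emeasure_space_le_1) simp
  finally show ?thesis by simp
qed

text \<open>Here \<open>p\<close> is the full stack, with the current vertex on top. For bounded
  \<open>f\<close> the integral is finite, so \<open>enn2real\<close> loses nothing.\<close>

definition erasure_exp :: "(nat list \<Rightarrow> real) \<Rightarrow> nat list \<Rightarrow> real" where
  "erasure_exp f p = enn2real (erasure_int f (tl p) (hd p))"

text \<open>From the top of the stack the next vertex is uniform on the \<open>n - 1\<close> others:
  it lies in \<open>S\<close> and ends the walk, or is fresh and is pushed, or lies in
  \<open>tl p\<close> and causes a pop. Adding \<open>erasure_exp f p\<close> to both sides turns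
  \<open>n - 1\<close> into \<open>n\<close> and the suffix sum of \<open>tl p\<close> into that of
  \<open>p\<close>.\<close>

lemma erasure_exp_harmonic:
  assumes "stack p" "p \<noteq> []" and f: "\<And>r. 0 \<le> f r" "\<And>r. f r \<le> B"
  shows "real n * erasure_exp f p = (\<Sum>u\<in>S. f (rev p @ [u])) +
    (\<Sum>y\<in>{1..n} - S - set p. erasure_exp f (y # p)) + suffix_sum (erasure_exp f) p"
proof -
  obtain x q where p: "p = x # q" using assms by (cases p) auto
  have x: "x \<in> {1..n}" "x \<notin> S" "x \<notin> set q" and q: "distinct q" "set q \<subseteq> {1..n} - S"
    using assms p by (auto simp: stack_def)
  have fin: "finite S" using S finite_subset by blast
  have "0 \<le> B" using f[of "[]"] by linarith
  then have ub: "erasure_int f q y < \<top>" for q y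
    using erasure_int_bound[where f = f and B = B and q = q and x = y] f(2)
    by (meson ennreal_less_top le_less_trans)
  have n: "n - 1 > 0"
  proof -
    obtain u where "u \<in> S" using S by blast
    then show ?thesis using x S by (cases n) auto
  qed
  let ?e = "\<lambda>y. enn2real (erasure_int f p y)"
  have "erasure_int f q x = (\<Sum>y\<in>{1..n} - {x}. erasure_int f p y) / of_nat (n - 1)"
    using erasure_int_step[of x q f] assms(1) p by simp
  also have "\<dots> = ennreal ((\<Sum>y\<in>{1..n} - {x}. ?e y) / real (n - 1))"
    using ub n by (simp add: divide_ennreal[symmetric] sum_nonneg ennreal_of_nat_eq_real_of_nat flip: sum_ennreal)
  finally have "erasure_exp f p = (\<Sum>y\<in>{1..n} - {x}. ?e y) / real (n - 1)"
    unfolding erasure_exp_def p by (simp add: sum_nonneg)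
  then have "real (n - 1) * erasure_exp f p = (\<Sum>y\<in>{1..n} - {x}. ?e y)" using n by simp
  also have "{1..n} - {x} = S \<union> (({1..n} - S - set p) \<union> set q)"
    using x q S unfolding p by auto
  also have "(\<Sum>y\<in>\<dots>. ?e y) = (\<Sum>y\<in>S. ?e y) + ((\<Sum>y\<in>{1..n} - S - set p. ?e y) + (\<Sum>y\<in>set q. ?e y))"
    using x q fin unfolding p by (subst sum.union_disjoint; (subst sum.union_disjoint)?) auto
  also have "(\<Sum>y\<in>S. ?e y) = (\<Sum>u\<in>S. f (rev p @ [u]))"
    using assms by (intro sum.cong) (auto simp: erasure_int_hit)
  also have "(\<Sum>y\<in>{1..n} - S - set p. ?e y) = (\<Sum>y\<in>{1..n} - S - set p. erasure_exp f (y # p))"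
    by (simp add: erasure_exp_def)
  also have "(\<Sum>y\<in>set q. ?e y) = (\<Sum>y\<in>set q. erasure_exp f (dropWhile (\<lambda>z. z \<noteq> y) q))"
  proof (intro sum.cong refl)
    fix y assume y: "y \<in> set q"
    then have "hd (dropWhile (\<lambda>z. z \<noteq> y) q) = y"
      using hd_dropWhile[of "\<lambda>z. z \<noteq> y" q] by (auto simp: dropWhile_eq_Nil_conv)
    then show "?e y = erasure_exp f (dropWhile (\<lambda>z. z \<noteq> y) q)"
      using y x assms(1) erasure_int_return[of y p f] unfolding erasure_exp_def p by auto
  qed
  also have "\<dots> = suffix_sum (erasure_exp f) q" using q by (simp add: sum_dropWhile_eq_suffix_sum)
  finally show ?thesis using n by (simp add: p algebra_simps of_nat_diff)
qed

\<comment> \<open>Maximum principle: with probability at least \<open>card S / (n - 1)\<close> the next step hits \<open>S\<close>, so the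
  difference of two bounded harmonic functions contracts and hence vanishes.\<close>
lemma harmonic_unique:
  fixes e g h :: "nat list \<Rightarrow> real"
  assumes e: "\<And>p. stack p \<Longrightarrow> p \<noteq> [] \<Longrightarrow> real n * e p = g p +
      (\<Sum>y\<in>{1..n} - S - set p. e (y # p)) + suffix_sum e p"
    and h: "\<And>p. stack p \<Longrightarrow> p \<noteq> [] \<Longrightarrow> real n * h p = g p +
      (\<Sum>y\<in>{1..n} - S - set p. h (y # p)) + suffix_sum h p"
    and p: "stack p" "p \<noteq> []"
  shows "e p = h p"
proof -
  define A where "A = {p. stack p \<and> p \<noteq> []}"
  have fA: "finite A" unfolding A_def using finite_stack by (rule rev_finite_subset) auto
  define M where "M = Max ((\<lambda>p. \<bar>e p - h p\<bar>) ` A)"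
  have pA: "p \<in> A" using p by (simp add: A_def)
  have le: "\<bar>e p - h p\<bar> \<le> M" if "p \<in> A" for p unfolding M_def using that fA by (intro Max_ge) auto
  have "M \<in> (\<lambda>p. \<bar>e p - h p\<bar>) ` A" unfolding M_def using fA pA by (intro Max_in) auto
  then obtain m where m: "m \<in> A" "\<bar>e m - h m\<bar> = M" by auto
  obtain x q where mx: "m = x # q" using m by (cases m) (auto simp: A_def)
  have st: "stack m" "m \<noteq> []" using m by (auto simp: A_def)
  let ?N = "{1..n} - S - set m"
  have 1: "real n * e m - real n * h m = (\<Sum>y\<in>?N. e (y # m) - h (y # m)) + (suffix_sum e m - suffix_sum h m)"
    using e[OF st] h[OF st] by (simp add: sum_subtractf)
  \<comment> \<open>The first term of each suffix sum is the value at \<open>m\<close> itself;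
    moving it to the left leaves the factor \<open>n - 1\<close>.\<close>
  then have "(real n - 1) * (e m - h m) =
      (\<Sum>y\<in>?N. e (y # m) - h (y # m)) + (suffix_sum e q - suffix_sum h q)"
    by (simp add: mx algebra_simps)
  moreover have "\<bar>\<Sum>y\<in>?N. e (y # m) - h (y # m)\<bar> \<le> real (card ?N) * M"
  proof -
    have "\<bar>\<Sum>y\<in>?N. e (y # m) - h (y # m)\<bar> \<le> (\<Sum>y\<in>?N. \<bar>e (y # m) - h (y # m)\<bar>)" by (rule sum_abs)
    also have "\<dots> \<le> (\<Sum>y\<in>?N. M)" using st by (intro sum_mono le) (auto simp: A_def stack_def)
    finally show ?thesis by simp
  qed
  moreover have "\<bar>suffix_sum e q - suffix_sum h q\<bar> \<le> length q * M"
  proof (rule suffix_sum_le)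
    fix a b assume "q = a @ b" "b \<noteq> []"
    then show "\<bar>e b - h b\<bar> \<le> M" using st mx by (intro le) (auto simp: A_def stack_def)
  qed
  ultimately have "\<bar>(real n - 1) * (e m - h m)\<bar> \<le> (real (card ?N) + length q) * M"
    by (simp add: algebra_simps)
  moreover have "card ?N + card S + length q + 1 = n" using stack_card[OF st(1)] mx by simp
  then have "real n = real (card ?N) + real (card S) + real (length q) + 1" by linarith
  \<comment> \<open>Of the \<open>n - 1\<close> possible moves only
    \<open>card ?N + length q\<close> contribute, because the boundary terms on \<open>S\<close>
    cancel.\<close>
  ultimately have "(real (card ?N) + real (card S) + real (length q)) * M \<le> (real (card ?N) + length q) * M"
    using m(2) by (simp add: abs_mult)
  then have "real (card S) * M \<le> 0" by (simp add: algebra_simps)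
  moreover have "card S > 0" using S finite_subset[OF S(1)] by (simp add: card_gt_0_iff)
  ultimately have "M \<le> 0" by (simp add: mult_le_0_iff)
  then show ?thesis using le[OF pA] by simp
qed

text \<open>This reduces an expectation over the loop-erasure to exhibiting one solution of the
  harmonic equation. Boundedness of \<open>f\<close> keeps the integral finite, so that uniqueness
  applies to it.\<close>

lemma nn_integral_loop_erasure:
  assumes f: "\<And>r. 0 \<le> f r" "\<And>r. f r \<le> B" and v: "v \<in> {1..n} - S"
    and h: "\<And>p. stack p \<Longrightarrow> p \<noteq> [] \<Longrightarrow> real n * h p = (\<Sum>u\<in>S. f (rev p @ [u])) +
      (\<Sum>y\<in>{1..n} - S - set p. h (y # p)) + suffix_sum h p"
  shows "(\<integral>\<^sup>+ w. ennreal (f (loop_erasure w)) \<partial>measure_spmf (random_walk (complete_graph n) S v)) =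
    ennreal (h [v])"
proof -
  have "erasure_exp f [v] = h [v]"
    using v by (intro harmonic_unique[of "erasure_exp f" "\<lambda>p. \<Sum>u\<in>S. f (rev p @ [u])"]
        erasure_exp_harmonic[OF _ _ f] h) (auto simp: stack_def)
  moreover have "0 \<le> B" using f[of "[]"] by linarith
  then have "erasure_int f [] v < \<top>"
    using erasure_int_bound[where f = f and B = B and q = "[]" and x = v] f(2)
    by (meson ennreal_less_top le_less_trans)
  ultimately have "erasure_int f [] v = ennreal (h [v])"
    using ennreal_enn2real[of "erasure_int f [] v"] by (simp add: erasure_exp_def)
  then show ?thesis by (simp add: erasure_int_def loop_erasure_def)
qed

text \<open>The total mass is the expectation of the constant 1, and the constant potential 1 is
  harmonic because the three classes of vertices add up to \<open>n\<close>.\<close>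

lemma lossless_random_walk:
  assumes v: "v \<in> {1..n}"
  shows "lossless_spmf (random_walk (complete_graph n) S v)"
proof (cases "v \<in> S")
  case True
  then show ?thesis by (simp add: random_walk_hit)
next
  case False
  have "(\<integral>\<^sup>+ w. ennreal 1 \<partial>measure_spmf (random_walk (complete_graph n) S v)) = ennreal 1"
  proof (rule nn_integral_loop_erasure[of "\<lambda>_. 1" 1 v "\<lambda>_. 1"])
    fix p assume p: "stack p"
    have [simp]: "suffix_sum (\<lambda>_. 1::real) p = length p" for p :: "nat list" by (induction p) auto
    have "real n = real (card ({1..n} - S - set p)) + real (card S) + real (length p)"
      using stack_card[OF p] by linarith
    then show "real n * 1 = (\<Sum>u\<in>S. 1) + (\<Sum>y\<in>{1..n} - S - set p. 1) + suffix_sum (\<lambda>_. 1) p" by simp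
  qed (use v False in auto)
  then show ?thesis
    by (simp add: lossless_spmf_def weight_spmf_def measure_spmf.emeasure_eq_measure space_measure_spmf)
qed

end

section \<open>The law of the loop-erasure\<close>

text \<open>
  The potentials below solve the harmonic equation of \<open>nn_integral_loop_erasure\<close> for the
  event that the loop-erasure is a given path. With \<open>P p\<close> saying that the stack \<open>p\<close> is an
  initial segment of that path, \<open>hit_pot\<close> is the probability of the event given the stack, and
  \<open>off_pot\<close> is this probability after one further push that leaves the path.
\<close>

fun off_pot :: "real \<Rightarrow> real \<Rightarrow> real \<Rightarrow> ('a list \<Rightarrow> bool) \<Rightarrow> 'a list \<Rightarrow> real" where
  "off_pot K n s P [] = 0"
| "off_pot K n s P (y # q) = off_pot K n s P q +
     (if P (y # q) then K * n ^ length q / ((s + length q) * (s + length q + 1)) else 0)"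

fun hit_pot :: "real \<Rightarrow> real \<Rightarrow> real \<Rightarrow> ('a list \<Rightarrow> bool) \<Rightarrow> 'a list \<Rightarrow> real" where
  "hit_pot K n s P [] = 0"
| "hit_pot K n s P (y # q) = off_pot K n s P q +
     (if P (y # q) then K * n ^ length q / (s + length q) else 0)"

text \<open>With \<open>t = s + length q\<close>, the increment \<open>c / (t * (t + 1))\<close> of
  \<open>off_pot\<close> times \<open>t + 1\<close> is the extra term \<open>c / t\<close> of
  \<open>hit_pot\<close>. So \<open>off_pot\<close> is the average of \<open>hit_pot\<close> over
  the suffixes together with \<open>s\<close> zeros for the hits of \<open>S\<close>.\<close>

lemma suffix_sum_hit_pot:
  assumes "s > 0"
  shows "suffix_sum (hit_pot K n s P) p = (s + length p) * off_pot K n s P p"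
proof (induction p)
  case (Cons y q)
  define t where "t = s + length q"
  have t: "t > 0" "s + real (length (y # q)) = t + 1" using assms by (simp_all add: t_def)
  have "t + 1 \<noteq> 0" using t by simp
  then have "(t + 1) * (c / (t * (t + 1))) = c / t" for c by (simp del: add_eq_0_iff)
  then show ?case using Cons unfolding t(2) by (simp add: distrib_left flip: t_def) (simp add: algebra_simps)
qed simp

text \<open>Partial fractions: \<open>1 / t = 1 / (t * (t + 1)) + 1 / (t + 1)\<close>. The last
  summand is the contribution of the one move that follows the path.\<close>

lemma hit_pot_eq_off_pot:
  assumes "s > 0" "p \<noteq> []"
  shows "n * hit_pot K n s P p =
    n * off_pot K n s P p + (if P p then K * n ^ length p / (s + length p) else 0)"
proof -
  obtain y q where p: "p = y # q" using assms by (cases p) auto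
  define t where "t = s + length q"
  have t: "t > 0" "s + real (length p) = t + 1" using assms p by (simp_all add: t_def)
  have "t + 1 \<noteq> 0" using t by simp
  then have "c / t = c / (t * (t + 1)) + c / (t + 1)" for c
    using t(1) by (simp add: divide_simps) (simp add: algebra_simps)
  from this[of "K * n ^ length q"] show ?thesis
    unfolding t(2) unfolding p by (simp add: distrib_left flip: t_def)
qed

lemma nn_integral_loop_erasure_eq:
  fixes n :: nat
  assumes S: "S \<subseteq> {1..n}" "S \<noteq> {}" and v: "v \<in> {1..n} - S"
    and \<gamma>: "path_into S v \<gamma>" "set \<gamma> \<subseteq> {1..n}" and D: "D = length \<gamma> - 1" and s: "s = card S"
  shows "(\<integral>\<^sup>+ w. ennreal (if loop_erasure w = \<gamma> then 1 else 0)
      \<partial>measure_spmf (random_walk (complete_graph n) S v)) = ennreal (real (s + D) / real (s * n ^ D))"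
proof -
  define vs where "vs = butlast \<gamma>"
  define u where "u = last \<gamma>"
  have \<gamma>eq: "\<gamma> = vs @ [u]" and u: "u \<in> S" and vs: "distinct vs" "set vs \<subseteq> {1..n} - S"
    using \<gamma> in_set_butlastD[of _ \<gamma>] unfolding vs_def u_def path_into_def
    by (auto simp: distinct_butlast)
  have D: "D = length vs" using D by (simp add: \<gamma>eq)
  have "vs \<noteq> []" using \<gamma> v u by (auto simp: \<gamma>eq path_into_def)
  then have hd: "hd vs = v" using \<gamma> by (auto simp: \<gamma>eq path_into_def)
  have s0: "s > 0" using S finite_subset[OF S(1)] s by (simp add: card_gt_0_iff)
  have n0: "n > 0" using v by auto
  define P where "P p \<longleftrightarrow> rev p = take (length p) vs" for p
  \<comment> \<open>\<open>K\<close> makes \<open>K * n ^ d / (s + d)\<close> equal to 1 at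
    \<open>d = D\<close>, when the path is on the stack up to its end in \<open>S\<close>.\<close>
  define K where "K = (s + D) / real n ^ D"
  let ?A = "off_pot K n s P" and ?h = "hit_pot K n s P"
  have "(\<integral>\<^sup>+ w. ennreal (if loop_erasure w = \<gamma> then 1 else 0)
      \<partial>measure_spmf (random_walk (complete_graph n) S v)) = ennreal (?h [v])"
  proof (rule nn_integral_loop_erasure[OF S, of "\<lambda>r. if r = \<gamma> then 1 else 0" 1])
    fix p assume p: "stack n S p" "p \<noteq> []"
    let ?N = "{1..n} - S - set p" and ?d = "length p"
    have P_le: "?d \<le> D" if "P p"
      using arg_cong[OF that[unfolded P_def], of length] by (simp add: D)
    have "(\<Sum>u'\<in>S. if rev p @ [u'] = \<gamma> then 1 else 0 :: real) = (\<Sum>u'\<in>S. if u' = u then if rev p = vs then 1 else 0 else 0)"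
      by (intro sum.cong) (auto simp: \<gamma>eq)
    also have "\<dots> = (if rev p = vs then 1 else 0)"
      using u finite_subset[OF S(1)] by (simp add: sum.delta)
    \<comment> \<open>The move to \<open>u\<close> at \<open>d = D\<close> and the push of
      \<open>vs ! d\<close> at \<open>d < D\<close> contribute the same expression, so together they
      give the last term of \<open>hit_pot_eq_off_pot\<close>.\<close>
    also have "\<dots> = (if P p \<and> ?d = D then K * n ^ ?d / (s + ?d) else 0)"
      using n0 s0 by (auto simp: P_def D K_def)
    finally have 1: "(\<Sum>u'\<in>S. if rev p @ [u'] = \<gamma> then 1 else 0 :: real) = \<dots>" .
    have P_Cons: "P (y # p) \<longleftrightarrow> P p \<and> ?d < D \<and> y = vs ! ?d" for y
    proof (cases "?d < D")
      case True
      then show ?thesis by (auto simp: P_def D take_Suc_conv_app_nth)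
    next
      case False
      then show ?thesis
        using arg_cong[of "rev (y # p)" "take (Suc ?d) vs" length] by (auto simp: P_def D)
    qed
    have N: "vs ! ?d \<in> ?N" if "P p" "?d < D"
    proof -
      have "set p = set (take ?d vs)" using that(1) by (metis P_def set_rev)
      moreover have "vs ! ?d \<notin> set (take ?d vs)"
        using that(2) vs(1) by (auto simp: D in_set_conv_nth nth_eq_iff_index_eq)
      moreover have "vs ! ?d \<in> set vs" using that(2) by (simp add: D)
      ultimately show ?thesis using vs(2) by auto
    qed
    have "?h (y # p) = ?A p +
        (if y = vs ! ?d then if P p \<and> ?d < D then K * n ^ ?d / (s + ?d) else 0 else 0)" for y
      by (auto simp: P_Cons)
    then have "(\<Sum>y\<in>?N. ?h (y # p)) = card ?N * ?A p +
        (\<Sum>y\<in>?N. if y = vs ! ?d then if P p \<and> ?d < D then K * n ^ ?d / (s + ?d) else 0 else 0)"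
      by (simp only: sum.distrib sum_constant)
    also have "\<dots> = card ?N * ?A p + (if P p \<and> ?d < D then K * n ^ ?d / (s + ?d) else 0)"
      using N by (auto simp: sum.delta)
    finally have 2: "(\<Sum>y\<in>?N. ?h (y # p)) = \<dots>" .
    have "card ?N + s + ?d = n" using stack_card[OF S p(1)] s by simp
    \<comment> \<open>This splits \<open>n * ?A p\<close> into the share of the pushes and the share
      \<open>s + d\<close> of the suffix sum.\<close>
    then have 3: "real n = card ?N + (s + real ?d)" by linarith
    show "real n * ?h p = (\<Sum>u\<in>S. if rev p @ [u] = \<gamma> then 1 else 0) + (\<Sum>y\<in>?N. ?h (y # p)) + suffix_sum ?h p"
      unfolding 1 2 using s0 p(2) P_le
      by (subst hit_pot_eq_off_pot, simp, simp, subst suffix_sum_hit_pot, simp, subst 3)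
         (auto simp: algebra_simps)
  qed (use v in auto)
  also have "?h [v] = real (s + D) / real (s * n ^ D)"
    using \<open>vs \<noteq> []\<close> hd by (cases vs) (auto simp: P_def K_def field_simps)
  finally show ?thesis .
qed

section \<open>The running time of a branch\<close>

text \<open>The expected value of \<open>time_pot\<close> after the branch is added, given a stack
  of \<open>d > 0\<close> vertices; \<open>d = 0\<close> only anchors the recursion. In closed form
  it is \<open>n - s - s * (1 / s + ... + 1 / (s + d - 1))\<close>.\<close>

fun length_pot :: "real \<Rightarrow> real \<Rightarrow> nat \<Rightarrow> real" where
  "length_pot n s 0 = n - s"
| "length_pot n s (Suc d) = length_pot n s d - s / (s + d)"

lemma suffix_sum_length_pot:
  assumes "s > 0"
  shows "suffix_sum (\<lambda>p. length_pot n s (length p)) p =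
    (s + length p) * length_pot n s (length p) - s * (n - s - length p)"
proof (induction p)
  case (Cons y q)
  define t r where "t = s + length q" and "r = s / t"
  have t: "t > 0" "s + real (length (y # q)) = t + 1" "n - s - length (y # q) = n - t - 1"
    "n - s - length q = n - t"
    using assms by (simp_all add: t_def)
  have "t * r = s" using t by (simp add: r_def)
  then show ?case using Cons unfolding t(2-4)
    by (simp flip: t_def r_def) (simp add: algebra_simps)
qed simp

\<comment> \<open>The expected number of steps of Wilson's algorithm from a tree with \<open>s\<close> vertices is
  \<open>(n - 1) / n * time_pot n s\<close>: it is the sum over the other vertices of the expected number
  of visits of the random walk started there.\<close>
definition time_pot :: "nat \<Rightarrow> nat \<Rightarrow> real" where
  "time_pot n x = (real n - real x) * (1 + 1 / real x)"

lemma time_pot_le: "n > 0 \<Longrightarrow> time_pot n x \<le> 2 * real n"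
proof -
  assume "n > 0"
  \<comment> \<open>\<open>1 / real x\<close> is at most 1 even at \<open>x = 0\<close>, where the
    division yields 0.\<close>
  have "time_pot n x \<le> real n * 2" if "x < n" unfolding time_pot_def
    using that by (intro mult_mono) (auto simp: divide_le_eq_1)
  moreover have "time_pot n x \<le> 0" if "\<not> x < n" unfolding time_pot_def
    using that by (intro mult_nonpos_nonneg) auto
  ultimately show ?thesis using \<open>n > 0\<close> by (cases "x < n") auto
qed

text \<open>\<open>length_pot\<close> solves the harmonic equation for the potential of the enlarged
  tree. The mean drop of the potential is therefore \<open>n / card S\<close>, which pays for the at
  most \<open>(n - 1) / card S\<close> expected steps.\<close>

lemma nn_integral_time_pot:
  fixes n :: nat
  assumes S: "S \<subseteq> {1..n}" "S \<noteq> {}" and v: "v \<in> {1..n} - S"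
  shows "(\<integral>\<^sup>+ w. ennreal (time_pot n (card S + length (loop_erasure w) - 1))
      \<partial>measure_spmf (random_walk (complete_graph n) S v)) = ennreal (real n - card S - 1)"
proof -
  \<comment> \<open>The maximum makes \<open>?f\<close> nonnegative on all lists, also on those too
    long to be a branch; \<open>ennreal\<close> truncates at 0 anyway. The last vertex of a branch
    is already in \<open>S\<close>, hence the \<open>- 1\<close>.\<close>
  let ?f = "\<lambda>r. max 0 (time_pot n (card S + length r - 1))"
  let ?h = "\<lambda>p. length_pot n (card S) (length p)"
  have s0: "card S > 0" using S finite_subset[OF S(1)] by (simp add: card_gt_0_iff)
  have n0: "n > 0" using v by auto
  have [simp]: "ennreal (max 0 x) = ennreal x" for x :: real by (simp add: max_def ennreal_neg)
  have "(\<integral>\<^sup>+ w. ennreal (?f (loop_erasure w)) \<partial>measure_spmf (random_walk (complete_graph n) S v)) =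
      ennreal (?h [v])"
  proof (rule nn_integral_loop_erasure[OF S, of ?f "2 * real n"])
    fix p assume p: "stack n S p" "p \<noteq> []"
    define x where "x = card S + length p"
    have c: "card ({1..n} - S - set p) + x = n" using stack_card[OF S p(1)] by (simp add: x_def)
    have "real x \<le> real n" using c by linarith
    then have "0 \<le> time_pot n x" by (simp add: time_pot_def)
    then have f: "?f (rev p @ [u]) = time_pot n x" for u by (simp add: x_def)
    have N: "real (card ({1..n} - S - set p)) = real n - x" "real n - card S - length p = real n - x"
      using c by (simp_all add: x_def)
    define r where "r = card S / real x"
    have x: "real x > 0" using s0 by (simp add: x_def)
    let ?g = "length_pot n (card S) (length p)"
    have "(\<Sum>u\<in>S. ?f (rev p @ [u])) = (real n - x) * (card S + r)"
      using x unfolding f by (simp add: time_pot_def r_def field_simps)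
    moreover have "(\<Sum>y\<in>{1..n} - S - set p. ?h (y # p)) = (real n - x) * (?g - r)"
      by (simp only: list.size(4) sum_constant N) (simp add: r_def x_def)
    moreover have "suffix_sum ?h p = x * ?g - card S * (real n - x)"
      using s0 by (simp only: suffix_sum_length_pot of_nat_0_less_iff N) (simp add: x_def)
    ultimately show "real n * ?h p = (\<Sum>u\<in>S. ?f (rev p @ [u])) + (\<Sum>y\<in>{1..n} - S - set p. ?h (y # p)) +
        suffix_sum ?h p"
      by (simp only:) (simp add: algebra_simps)
  qed (use v n0 time_pot_le[OF n0] in auto)
  then show ?thesis using s0 by simp
qed

text \<open>Each step hits \<open>S\<close> with chance \<open>card S / (n - 1)\<close>, so
  \<open>c = (n - 1) / card S\<close> satisfies
  \<open>(n - 1) * c = card S + (n - 1 - card S) * (1 + c)\<close>. Truncating at \<open>K\<close>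
  gives an induction that does not presuppose a finite expectation.\<close>

lemma nn_integral_steps_truncated:
  fixes n :: nat
  assumes S: "S \<subseteq> {1..n}" "S \<noteq> {}" and v: "v \<in> {1..n} - S"
  shows "(\<integral>\<^sup>+ w. of_nat (min (length w - 1) K) \<partial>measure_spmf (random_walk (complete_graph n) S v))
    \<le> ennreal (real (n - 1) / card S)"
  using v
proof (induction K arbitrary: v)
  case (Suc K)
  have s0: "card S > 0" and fin: "finite S" using S finite_subset[OF S(1)] by (simp_all add: card_gt_0_iff)
  define c where "c = real (n - 1) / card S"
  have c0: "c \<ge> 0" by (simp add: c_def)
  let ?R = "\<lambda>y. measure_spmf (random_walk (complete_graph n) S y)"
  let ?b = "\<lambda>y. if y \<in> S then 1 else ennreal (1 + c)"
  have step: "(\<integral>\<^sup>+ w. of_nat (min (length (v # w) - 1) (Suc K)) \<partial>?R y) \<le> ?b y"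
    if y: "y \<in> {1..n} - {v}" for y
  proof (cases "y \<in> S")
    case True
    then show ?thesis by (simp add: random_walk_hit measure_spmf_return_spmf nn_integral_return)
  next
    case False
    have "(\<integral>\<^sup>+ w. of_nat (min (length (v # w) - 1) (Suc K)) \<partial>?R y) =
        (\<integral>\<^sup>+ w. 1 + of_nat (min (length w - 1) K) \<partial>?R y)"
    proof (rule nn_integral_cong_AE, rule AE_measure_spmf_iff[THEN iffD2], rule ballI)
      fix w assume "w \<in> set_spmf (random_walk (complete_graph n) S y)"
      then have "w \<noteq> []" using set_spmf_random_walk y by blast
      then show "of_nat (min (length (v # w) - 1) (Suc K)) = (1 + of_nat (min (length w - 1) K) :: ennreal)"
        by (cases w) (simp_all add: min_def)
    qed
    also have "\<dots> = (\<integral>\<^sup>+ w. 1 \<partial>?R y) + (\<integral>\<^sup>+ w. of_nat (min (length w - 1) K) \<partial>?R y)"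
      by (intro nn_integral_add) auto
    also have "\<dots> \<le> 1 + ennreal c"
      using Suc.IH[of y] y False unfolding c_def[symmetric]
      by (intro add_mono) (auto simp: measure_spmf.emeasure_space_le_1)
    finally show ?thesis using False c0 by (simp add: ennreal_plus)
  qed
  have cd: "card ({1..n} - {v} - S) = n - 1 - card S"
    using S Suc.prems fin by (subst card_Diff_subset) auto
  have "card S \<le> card ({1..n} - {v})" using S Suc.prems by (intro card_mono) auto
  then have le: "card S \<le> n - 1" using Suc.prems by simp
  have "{1..n} - {v} = S \<union> ({1..n} - {v} - S)" using S Suc.prems by auto
  then have "(\<Sum>y\<in>{1..n} - {v}. ?b y) = (\<Sum>y\<in>S \<union> ({1..n} - {v} - S). ?b y)" by simp
  also have "\<dots> = (\<Sum>y\<in>S. ?b y) + (\<Sum>y\<in>{1..n} - {v} - S. ?b y)"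
    using fin by (intro sum.union_disjoint) auto
  also have "\<dots> = ennreal (real (card S) + real (n - 1 - card S) * (1 + c))"
    using cd c0 by (simp del: of_nat_diff add: ennreal_of_nat_eq_real_of_nat ennreal_plus ennreal_mult)
  also have "real (card S) + real (n - 1 - card S) * (1 + c) = real (n - 1) * c"
    using s0 le by (simp add: c_def of_nat_diff field_simps)
  finally have b: "(\<Sum>y\<in>{1..n} - {v}. ?b y) = of_nat (n - 1) * ennreal c"
    using c0 by (simp add: ennreal_of_nat_eq_real_of_nat ennreal_mult)
  have "(\<integral>\<^sup>+ w. of_nat (min (length w - 1) (Suc K)) \<partial>?R v) =
      (\<Sum>y\<in>{1..n} - {v}. \<integral>\<^sup>+ w. of_nat (min (length (v # w) - 1) (Suc K)) \<partial>?R y) / of_nat (n - 1)"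
    using Suc.prems by (simp add: random_walk_step nn_integral_bind_spmf nn_integral_spmf_of_set o_def)
  also have "\<dots> \<le> (\<Sum>y\<in>{1..n} - {v}. ?b y) / of_nat (n - 1)"
    by (intro divide_right_mono_ennreal sum_mono step)
  also have "\<dots> = ennreal c"
    unfolding b using s0 le c0 by (simp add: ennreal_of_nat_eq_real_of_nat divide_ennreal flip: ennreal_mult)
  finally show ?case by (simp add: c_def)
qed simp

lemma nn_integral_steps:
  fixes n :: nat
  assumes "S \<subseteq> {1..n}" "S \<noteq> {}" "v \<in> {1..n} - S"
  shows "(\<integral>\<^sup>+ w. of_nat (length w - 1) \<partial>measure_spmf (random_walk (complete_graph n) S v))
    \<le> ennreal (real (n - 1) / card S)"
proof -
  have "(SUP K. of_nat (min m K)) = (of_nat m :: ennreal)" for m :: nat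
    by (rule antisym[OF SUP_least]) (auto intro: SUP_upper2[of m])
  then have "(\<integral>\<^sup>+ w. of_nat (length w - 1) \<partial>measure_spmf (random_walk (complete_graph n) S v)) =
      (\<integral>\<^sup>+ w. (SUP K. of_nat (min (length w - 1) K)) \<partial>measure_spmf (random_walk (complete_graph n) S v))"
    by simp
  also have "\<dots> = (SUP K. \<integral>\<^sup>+ w. of_nat (min (length w - 1) K) \<partial>measure_spmf (random_walk (complete_graph n) S v))"
    by (intro nn_integral_monotone_convergence_SUP) (auto simp: incseq_def le_fun_def min_def)
  also have "\<dots> \<le> ennreal (real (n - 1) / card S)"
    by (intro SUP_least nn_integral_steps_truncated assms)
  finally show ?thesis .
qed

section \<open>Amortised cost of a branch\<close>

lemma length_dropWhile_takeWhile: "length (takeWhile P p) + length (dropWhile P p) = length p"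
  by (metis length_append takeWhile_dropWhile_id)

text \<open>The stack length serves as credit: a push costs 2 and stores 1 for its later pop, which
  gives 3 per vertex read.\<close>

lemma T_chron_erase_le: "T_chron_erase p w \<le> 3 * length w + length p"
proof (induction p w rule: T_chron_erase.induct)
  case (2 p x w)
  then show ?case using length_dropWhile_takeWhile[of "\<lambda>y. y \<noteq> x" p] by auto
qed simp

lemma length_chron_erase_le: "length (chron_erase p w) \<le> length p + length w"
proof (induction p w rule: chron_erase.induct)
  case (2 p x w)
  then show ?case using length_dropWhile_takeWhile[of "\<lambda>y. y \<noteq> x" p] by auto
qed simp

text \<open>The costs sum to at most \<open>7 * length w\<close>, and \<open>length w\<close> is at
  most \<open>2 * (length w - 1)\<close> for a walk with at least one step.\<close>

lemma T_branch_le: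
  assumes "length w \<ge> 2"
  shows "T_branch w \<le> 16 * (length w - 1)"
  using assms T_chron_erase_le[of "[]" w] length_chron_erase_le[of "[]" w]
  by (simp add: T_branch_def T_random_walk_def T_add_path_def loop_erasure_def)

section \<open>Wilson's algorithm on the complete graph\<close>

lemma nn_integral_measure_spmf_le:
  assumes "\<And>x. x \<in> set_spmf p \<Longrightarrow> f x \<le> B"
  shows "(\<integral>\<^sup>+ x. f x \<partial>measure_spmf p) \<le> B"
proof -
  have "(\<integral>\<^sup>+ x. f x \<partial>measure_spmf p) \<le> (\<integral>\<^sup>+ x. B \<partial>measure_spmf p)"
    using assms by (intro nn_integral_mono_AE) simp
  also have "\<dots> \<le> B * 1"
    unfolding nn_integral_const by (intro mult_left_mono measure_spmf.emeasure_space_le_1) simp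
  finally show ?thesis by simp
qed

lemma nn_integral_lossless_const:
  assumes "lossless_spmf p" "\<And>x. x \<in> set_spmf p \<Longrightarrow> f x = B"
  shows "(\<integral>\<^sup>+ x. f x \<partial>measure_spmf p) = B"
proof -
  have "(\<integral>\<^sup>+ x. f x \<partial>measure_spmf p) = (\<integral>\<^sup>+ x. B \<partial>measure_spmf p)"
    using assms(2) by (intro nn_integral_cong_AE) simp
  then show ?thesis using assms(1)
    by (simp add: measure_spmf.emeasure_eq_measure space_measure_spmf lossless_spmf_def weight_spmf_def)
qed

lemma expected_time_lossless:
  assumes "lossless_spmf p"
  shows "expected_time p = (\<integral>\<^sup>+ r. of_nat (snd r) \<partial>measure_spmf p)"
proof -
  obtain q where "p = spmf_of_pmf q" using assms lossless_spmf_conv_spmf_of_pmf by metis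
  then show ?thesis
    by (simp add: expected_time_def) (simp add: spmf_of_pmf_def case_prod_beta)
qed

section \<open>Subtrees of the complete graph grown by branches\<close>

lemma verts_complete_graph [simp]: "verts (complete_graph n) = {1..n}"
  by (simp add: complete_graph_def)

lemma subgraph_complete_graph_iff:
  "subgraph H (complete_graph n) \<longleftrightarrow> simple_graph H \<and> verts H \<subseteq> {1..n}"
  by (auto simp: subgraph_def complete_graph_def simple_graph_def)

lemma subtree_complete_graph_iff:
  "subtree H (complete_graph n) \<longleftrightarrow> is_tree H \<and> verts H \<subseteq> {1..n}"
  by (auto simp: subtree_def subgraph_complete_graph_iff is_tree_def)

text \<open>The last vertex of the branch lies in \<open>X\<close> already and \<open>v\<close> does
  not, so the branch brings \<open>length p - 1 > 0\<close> new vertices.\<close>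

lemma subtree_add_branch:
  assumes X: "subtree X (complete_graph n)" and v: "v \<in> {1..n} - verts X"
    and p: "path_into (verts X) v p" "set p \<subseteq> {1..n}"
  shows "subtree (add_path p X) (complete_graph n)"
    and "length p \<ge> 2"
    and "card (verts (add_path p X)) = card (verts X) + length p - 1"
proof -
  have t: "is_tree X" "verts X \<subseteq> {1..n}" using X by (auto simp: subtree_complete_graph_iff)
  have fin: "finite (verts X)" using t finite_subset by blast
  show "subtree (add_path p X) (complete_graph n)"
    using is_tree_add_path[OF t(1)] p t by (auto simp: subtree_complete_graph_iff path_into_def add_path_def)
  obtain a u where pu: "p = a @ [u]" using p by (metis path_into_def append_butlast_last_id)
  then have au: "u \<in> verts X" "set a \<inter> verts X = {}" "distinct a" using p by (auto simp: path_into_def)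
  moreover have "a \<noteq> []" using p v pu by (auto simp: path_into_def)
  then show "length p \<ge> 2" using pu by (cases a) auto
  have "verts (add_path p X) = verts X \<union> set a" using au pu by (auto simp: add_path_def)
  then have "card (verts (add_path p X)) = card (verts X) + card (set a)"
    using au fin by (simp only:) (subst card_Un_disjoint; auto)
  then show "card (verts (add_path p X)) = card (verts X) + length p - 1"
    using au pu by (simp add: distinct_card)
qed

text \<open>Every branch reduces the number of missing vertices. Facts about
  \<open>wilson_loop\<close> thus follow by ordinary induction on trees instead of fixed-point
  induction.\<close>

lemma wilson_induct [consumes 1, case_names finished branch]:
  assumes "subtree X (complete_graph n)"
    and "\<And>X. subtree X (complete_graph n) \<Longrightarrow> verts X = {1..n} \<Longrightarrow> P X"
    and "\<And>X. subtree X (complete_graph n) \<Longrightarrow> verts X \<noteq> {1..n} \<Longrightarrow>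
      (\<And>v w. v \<in> {1..n} - verts X \<Longrightarrow> w \<in> set_spmf (random_walk (complete_graph n) (verts X) v) \<Longrightarrow>
        P (add_path (loop_erasure w) X)) \<Longrightarrow> P X"
  shows "P X"
  using assms(1)
proof (induction "n - card (verts X)" arbitrary: X rule: less_induct)
  case less
  show ?case
  proof (cases "verts X = {1..n}")
    case True
    then show ?thesis using assms(2) less.prems by blast
  next
    case False
    show ?thesis
    proof (rule assms(3)[OF less.prems False])
      fix v w assume v: "v \<in> {1..n} - verts X"
        and w: "w \<in> set_spmf (random_walk (complete_graph n) (verts X) v)"
      let ?Y = "add_path (loop_erasure w) X"
      have p: "path_into (verts X) v (loop_erasure w)" "set (loop_erasure w) \<subseteq> {1..n}"
        using loop_erasure_random_walk[OF w] v by auto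
      note Y = subtree_add_branch[OF less.prems v p]
      have "card (verts ?Y) \<le> card {1..n}"
        using Y(1) by (intro card_mono) (auto simp: subtree_complete_graph_iff)
      then have "n - card (verts ?Y) < n - card (verts X)" using Y(2,3) by simp
      then show "P ?Y" using less.hyps Y(1) by blast
    qed
  qed
qed

section \<open>Law and cost of the main loop\<close>

lemma wilson_loop_finished:
  "verts X = {1..n} \<Longrightarrow> wilson_loop (complete_graph n) X k = return_spmf (X, k + 1)"
  by (subst wilson_loop.simps) simp

lemma wilson_loop_branch:
  "verts X \<noteq> {1..n} \<Longrightarrow> wilson_loop (complete_graph n) X k =
    bind_spmf (spmf_of_set ({1..n} - verts X))
      (\<lambda>v. bind_spmf (random_walk (complete_graph n) (verts X) v)
        (\<lambda>w. wilson_loop (complete_graph n) (add_path (loop_erasure w) X) (k + T_branch w)))"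
  by (subst wilson_loop.simps) simp

lemma subtree_start:
  assumes "subtree X (complete_graph n)"
  shows "verts X \<subseteq> {1..n}" "verts X \<noteq> {}" "finite (verts X)" "card (verts X) > 0"
  using assms finite_subset[of "verts X" "{1..n}"]
  by (auto simp: subtree_complete_graph_iff is_tree_def connected_graph_def card_gt_0_iff)

lemma set_spmf_wilson_loop:
  assumes "subtree X (complete_graph n)" "(T, k') \<in> set_spmf (wilson_loop (complete_graph n) X k)"
  shows "spanning_tree T (complete_graph n)"
  using assms
proof (induction X arbitrary: k rule: wilson_induct)
  case (finished X)
  then show ?case by (simp add: wilson_loop_finished spanning_tree_def)
next
  case (branch X)
  then obtain v w where "v \<in> {1..n} - verts X" "w \<in> set_spmf (random_walk (complete_graph n) (verts X) v)"
    "(T, k') \<in> set_spmf (wilson_loop (complete_graph n) (add_path (loop_erasure w) X) (k + T_branch w))"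
    unfolding wilson_loop_branch[OF branch(2)] by (simp add: set_bind_spmf bind_UNION Bex_def) blast
  then show ?case by (rule branch.IH)
qed

lemma lossless_wilson_loop:
  assumes "subtree X (complete_graph n)"
  shows "lossless_spmf (wilson_loop (complete_graph n) X k)"
  using assms
proof (induction X arbitrary: k rule: wilson_induct)
  case (finished X)
  then show ?case by (simp add: wilson_loop_finished)
next
  case (branch X)
  note X = subtree_start[OF branch(1)]
  have "{1..n} - verts X \<noteq> {}" using X branch(2) by blast
  then show ?case using branch lossless_random_walk[OF X(1,2)]
    by (auto simp: wilson_loop_branch)
qed

text \<open>A branch with \<open>D\<close> edges multiplies \<open>(s + D) / (s * n ^ D)\<close> by
  the value for \<open>s + D\<close> vertices, and \<open>s + D\<close> cancels. For a single
  starting vertex the value is the reciprocal of Cayley's number of spanning trees.\<close>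

lemma spmf_wilson_loop:
  assumes "subtree X (complete_graph n)" "spanning_tree T (complete_graph n)"
  shows "ennreal (spmf (map_spmf fst (wilson_loop (complete_graph n) X k)) T) =
    ennreal (if subgraph X T then n / (card (verts X) * n ^ (n - card (verts X))) else 0)"
  using assms(1)
proof (induction X arbitrary: k rule: wilson_induct)
  case (finished X)
  have T: "is_tree T" "verts T = {1..n}" using assms(2) by (auto simp: spanning_tree_def subtree_def)
  have X: "is_tree X" using finished by (simp add: subtree_def)
  have "n > 0" using subtree_start[OF finished(1)] finished(2) by simp
  moreover have "subgraph X T \<longleftrightarrow> X = T"
    using spanning_subtree_eq[OF X T(1)] T finished by (auto simp: subgraph_def is_tree_def)
  moreover have "card (verts X) = n" using finished(2) by simp
  ultimately show ?case using finished by (auto simp: wilson_loop_finished)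
next
  case (branch X)
  have T: "is_tree T" "verts T = {1..n}" using assms(2) by (auto simp: spanning_tree_def subtree_def)
  have tX: "is_tree X" using branch by (simp add: subtree_def)
  note X = subtree_start[OF branch(1)]
  have ne: "{1..n} - verts X \<noteq> {}" using X branch(2) by blast
  define s where "s = card (verts X)"
  let ?R = "random_walk (complete_graph n) (verts X)"
  let ?Y = "\<lambda>w. add_path (loop_erasure w) X"
  let ?W = "\<lambda>w k. map_spmf fst (wilson_loop (complete_graph n) (?Y w) k)"
  let ?c = "if subgraph X T then n / (s * n ^ (n - s)) else 0 :: real"
  \<comment> \<open>The inner integral is the same for every start, so the choice of
    \<open>v\<close> is immaterial.\<close>
  have branch_eq: "(\<integral>\<^sup>+ w. ennreal (spmf (?W w (k + T_branch w)) T) \<partial>measure_spmf (?R v)) = ennreal ?c"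
    if v: "v \<in> {1..n} - verts X" for v
  proof -
    have IH: "path_into (verts X) v (loop_erasure w) \<and> simple_graph (?Y w) \<and>
        ennreal (spmf (?W w (k + T_branch w)) T) =
        ennreal (if subgraph (?Y w) T then
          n / (real (s + length (loop_erasure w) - 1) * n ^ (n - (s + length (loop_erasure w) - 1))) else 0)"
      if w: "w \<in> set_spmf (?R v)" for w
    proof -
      have p: "path_into (verts X) v (loop_erasure w)" "set (loop_erasure w) \<subseteq> {1..n}"
        using loop_erasure_random_walk[OF w] v by auto
      then show ?thesis using branch(3)[OF v w] subtree_add_branch[OF branch(1) v p]
        by (simp add: s_def subtree_def is_tree_def)
    qed
    show ?thesis
    proof (cases "subgraph X T")
      case False
      have "\<not> subgraph (?Y w) T" for w using False tX
        by (auto simp: subgraph_def add_path_def is_tree_def)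
      then show ?thesis using IH False by (intro nn_integral_lossless_const lossless_random_walk[OF X(1,2)]) (use v in auto)
    next
      case True
      obtain \<gamma> where \<gamma>: "walk T \<gamma>" "path_into (verts X) v \<gamma>"
        using path_into_exists[of T v "verts X"] T v X by (auto simp: is_tree_def)
      have \<gamma>V: "set \<gamma> \<subseteq> {1..n}" using \<gamma> T by (simp add: walk_def)
      define D where "D = length \<gamma> - 1"
      note Y = subtree_add_branch[OF branch(1) v \<gamma>(2) \<gamma>V]
      have "card (verts (add_path \<gamma> X)) \<le> card {1..n}"
        using Y(1) by (intro card_mono) (auto simp: subtree_complete_graph_iff)
      then have D: "s + D \<le> n" "s + length \<gamma> - 1 = s + D" using Y by (simp_all add: D_def s_def)
      have s0: "s > 0" using X by (simp add: s_def)
      \<comment> \<open>\<open>C\<close> is the chance of ending in \<open>T\<close> once the only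
        admissible branch \<open>\<gamma>\<close> is in place.\<close>
      define C where "C = n / (real (s + D) * n ^ (n - (s + D)))"
      have "ennreal (spmf (?W w (k + T_branch w)) T) = ennreal C * ennreal (if loop_erasure w = \<gamma> then 1 else 0)"
        if w: "w \<in> set_spmf (?R v)" for w
      proof -
        have ne: "loop_erasure w \<noteq> []" using IH[OF w] by (simp add: path_into_def)
        have "subgraph (?Y w) T \<longleftrightarrow> loop_erasure w = \<gamma>"
          using subgraph_add_path[OF True _ ne] path_into_unique[OF _ True _ _ _ \<gamma>, of "loop_erasure w"]
            IH[OF w] T tX \<gamma> by (auto simp: is_tree_def)
        then show ?thesis using IH[OF w] D by (auto simp: C_def)
      qed
      then have "(\<integral>\<^sup>+ w. ennreal (spmf (?W w (k + T_branch w)) T) \<partial>measure_spmf (?R v)) =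
          (\<integral>\<^sup>+ w. ennreal C * ennreal (if loop_erasure w = \<gamma> then 1 else 0) \<partial>measure_spmf (?R v))"
        by (intro nn_integral_cong_AE) simp
      also have "\<dots> = ennreal C * ennreal (real (s + D) / real (s * n ^ D))"
        using nn_integral_loop_erasure_eq[OF X(1,2) v \<gamma>(2) \<gamma>V D_def s_def]
        by (subst nn_integral_cmult) auto
      also have "\<dots> = ennreal (C * (real (s + D) / real (s * n ^ D)))"
        by (rule ennreal_mult[symmetric]) (auto simp: C_def)
      also have "C * (real (s + D) / real (s * n ^ D)) = n / (s * (n ^ D * n ^ (n - (s + D))))"
        using s0 by (simp add: C_def)
      also have "n ^ D * n ^ (n - (s + D)) = n ^ (n - s)"
        using D(1) by (simp flip: power_add)
      finally show ?thesis using True by simp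
    qed
  qed
  show ?case
    unfolding s_def[symmetric] wilson_loop_branch[OF branch(2)] map_spmf_bind_spmf o_def ennreal_spmf_bind
  proof (rule nn_integral_lossless_const)
    show "lossless_spmf (spmf_of_set ({1..n} - verts X))" using ne by (simp only: lossless_spmf_of_set) simp
  qed (use branch_eq in simp)
qed

text \<open>A branch costs at most 16 per step of its walk, and the expected number of steps is
  covered by the mean drop of \<open>time_pot\<close>. The 1 in \<open>k + 1\<close> is the final
  loop test.\<close>

lemma nn_integral_wilson_loop_time:
  assumes "subtree X (complete_graph n)"
  shows "(\<integral>\<^sup>+ r. of_nat (snd r) \<partial>measure_spmf (wilson_loop (complete_graph n) X k)) \<le>
    of_nat (k + 1) + 16 * ennreal (time_pot n (card (verts X)))"
  using assms
proof (induction X arbitrary: k rule: wilson_induct)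
  case (finished X)
  then show ?case by (simp add: wilson_loop_finished measure_spmf_return_spmf nn_integral_return)
next
  case (branch X)
  note X = subtree_start[OF branch(1)]
  define s where "s = card (verts X)"
  let ?R = "random_walk (complete_graph n) (verts X)"
  let ?Y = "\<lambda>w. add_path (loop_erasure w) X"
  let ?tp = "\<lambda>w. ennreal (time_pot n (s + length (loop_erasure w) - 1))"
  have "card (verts X) < card {1..n}" using X branch(2) by (intro psubset_card_mono) auto
  then have s: "s < n" "s > 0" using X by (auto simp: s_def)
  have "(\<integral>\<^sup>+ w. \<integral>\<^sup>+ r. of_nat (snd r) \<partial>measure_spmf (wilson_loop (complete_graph n) (?Y w) (k + T_branch w))
      \<partial>measure_spmf (?R v)) \<le> of_nat (k + 1) + 16 * ennreal (time_pot n s)"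
    if v: "v \<in> {1..n} - verts X" for v
  proof -
    have "(\<integral>\<^sup>+ r. of_nat (snd r) \<partial>measure_spmf (wilson_loop (complete_graph n) (?Y w) (k + T_branch w))) \<le>
        of_nat (k + 1) + (16 * of_nat (length w - 1) + 16 * ?tp w)" (is "?I \<le> _")
      if w: "w \<in> set_spmf (?R v)" for w
    proof -
      have p: "path_into (verts X) v (loop_erasure w)" "set (loop_erasure w) \<subseteq> {1..n}"
        using loop_erasure_random_walk[OF w] v by auto
      note Y = subtree_add_branch[OF branch(1) v p]
      have "length w \<ge> 2"
        using Y(2) length_chron_erase_le[of "[]" w] by (simp add: loop_erasure_def)
      then have "of_nat (k + T_branch w + 1) \<le> (of_nat (k + 1 + 16 * (length w - 1)) :: ennreal)"
        using T_branch_le by (intro of_nat_mono) simp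
      moreover have "?I \<le> of_nat (k + T_branch w + 1) + 16 * ?tp w"
        using branch(3)[OF v w, of "k + T_branch w"] Y(3) by (simp add: s_def)
      ultimately have "?I \<le> of_nat (k + 1 + 16 * (length w - 1)) + 16 * ?tp w"
        by (meson add_right_mono order_trans)
      then show ?thesis by (simp add: add.assoc)
    qed
    then have "(\<integral>\<^sup>+ w. \<integral>\<^sup>+ r. of_nat (snd r) \<partial>measure_spmf (wilson_loop (complete_graph n) (?Y w) (k + T_branch w))
        \<partial>measure_spmf (?R v)) \<le>
      (\<integral>\<^sup>+ w. of_nat (k + 1) + (16 * of_nat (length w - 1) + 16 * ?tp w) \<partial>measure_spmf (?R v))"
      by (intro nn_integral_mono_AE) simp
    also have "\<dots> = (\<integral>\<^sup>+ w. of_nat (k + 1) \<partial>measure_spmf (?R v)) +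
        (16 * (\<integral>\<^sup>+ w. of_nat (length w - 1) \<partial>measure_spmf (?R v)) + 16 * (\<integral>\<^sup>+ w. ?tp w \<partial>measure_spmf (?R v)))"
      by (simp add: nn_integral_add nn_integral_cmult)
    also have "\<dots> \<le> of_nat (k + 1) + (16 * ennreal (real (n - 1) / s) + 16 * ennreal (real n - s - 1))"
      using nn_integral_steps[OF X(1,2) v] nn_integral_time_pot[OF X(1,2) v]
      by (intro add_mono mult_left_mono nn_integral_measure_spmf_le[where f = "\<lambda>_. of_nat (k + 1)"])
         (simp_all add: s_def)
    also have "16 * ennreal (real (n - 1) / s) + 16 * ennreal (real n - s - 1) =
        16 * ennreal (real (n - 1) / s + (real n - s - 1))"
      using s by (subst ennreal_plus) (auto simp: distrib_left)
    \<comment> \<open>The two sides differ by \<open>1 / s\<close>.\<close>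
    also have "real (n - 1) / s + (real n - s - 1) \<le> time_pot n s"
      using s by (simp add: time_pot_def field_simps of_nat_diff)
    finally show ?thesis by (simp add: add_left_mono mult_left_mono ennreal_leI)
  qed
  then show ?case
    unfolding s_def[symmetric] wilson_loop_branch[OF branch(2)] nn_integral_bind_spmf
    by (rule nn_integral_measure_spmf_le) simp
qed

section \<open>Random relabelling\<close>

lemma relabel_comp: "relabel f (relabel g G) = relabel (f \<circ> g) G"
  by (simp add: relabel_def image_comp o_def image_image)

lemma relabel_id [simp]: "relabel id G = G"
  by (simp add: relabel_def)

lemma relabel_inv:
  assumes "\<pi> permutes A"
  shows "relabel \<pi> (relabel (inv \<pi>) G) = G" "relabel (inv \<pi>) (relabel \<pi> G) = G"
  using permutes_inv_o[OF assms] by (simp_all add: relabel_comp)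

lemma subgraph_relabel:
  assumes "inj f" "subgraph H G"
  shows "subgraph (relabel f H) (relabel f G)"
  using assms(2) simple_graph_relabel[OF assms(1)] by (auto simp: subgraph_def relabel_def)

lemma spanning_tree_relabel:
  assumes "\<pi> permutes {1..n}" "spanning_tree t (complete_graph n)"
  shows "spanning_tree (relabel \<pi> t) (complete_graph n)"
  using assms is_tree_relabel[OF permutes_inj[OF assms(1)], of t] permutes_image[OF assms(1)]
  by (auto simp: spanning_tree_def subtree_complete_graph_iff relabel_def)

lemma isomorphic_relabel:
  assumes "\<pi> permutes A"
  shows "isomorphic (relabel \<pi> G) G"
proof -
  have "{u, v} \<in> edges (relabel \<pi> G) \<longleftrightarrow> {inv \<pi> u, inv \<pi> v} \<in> edges G" for u v
    using relabel_edge_iff[OF permutes_inj[OF permutes_inv[OF assms]], of u v "relabel \<pi> G"]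
    by (simp add: relabel_inv[OF assms])
  moreover have "bij_betw (inv \<pi>) (verts (relabel \<pi> G)) (verts G)"
    using permutes_inj[OF assms] unfolding relabel_def fst_conv
    by (auto intro!: bij_betw_imageI simp: inj_on_inv_into image_image inv_f_f inj_on_def)
  ultimately show ?thesis unfolding isomorphic_def by blast
qed

text \<open>The isomorphism extends to \<open>A\<close> by any bijection between the complements of
  the vertex sets, which have equal size.\<close>

lemma isomorphic_imp_relabel:
  assumes iso: "isomorphic G H" and G: "simple_graph G" "verts G \<subseteq> A" and H: "simple_graph H" "verts H \<subseteq> A"
    and A: "finite A"
  shows "\<exists>\<sigma>. \<sigma> permutes A \<and> relabel \<sigma> G = H"
proof -
  obtain f where f: "bij_betw f (verts G) (verts H)"
    "\<And>u v. u \<in> verts G \<Longrightarrow> v \<in> verts G \<Longrightarrow> {u, v} \<in> edges G \<longleftrightarrow> {f u, f v} \<in> edges H"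
    using iso unfolding isomorphic_def by blast
  have "card (A - verts G) = card (A - verts H)"
    using bij_betw_same_card[OF f(1)] G H A by (simp add: card_Diff_subset finite_subset[OF _ A])
  then obtain h where h: "bij_betw h (A - verts G) (A - verts H)"
    using finite_same_card_bij[of "A - verts G" "A - verts H"] A by auto
  define \<sigma> where "\<sigma> x = (if x \<in> verts G then f x else if x \<in> A then h x else x)" for x
  have "bij_betw \<sigma> (verts G) (verts H)" using f(1) by (rule bij_betw_cong[THEN iffD1, rotated]) (simp add: \<sigma>_def)
  moreover have "bij_betw \<sigma> (A - verts G) (A - verts H)"
    using h by (rule bij_betw_cong[THEN iffD1, rotated]) (simp add: \<sigma>_def)
  ultimately have "bij_betw \<sigma> (verts G \<union> (A - verts G)) (verts H \<union> (A - verts H))"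
    by (rule bij_betw_combine) auto
  moreover have "verts G \<union> (A - verts G) = A" "verts H \<union> (A - verts H) = A" using G H by auto
  ultimately have "\<sigma> permutes A" using G by (intro bij_imp_permutes) (auto simp: \<sigma>_def)
  moreover have "relabel \<sigma> G = H"
  proof -
    have v: "\<sigma> ` verts G = verts H" using \<open>bij_betw \<sigma> (verts G) (verts H)\<close> by (simp add: bij_betw_def)
    have "(`) \<sigma> ` edges G = edges H"
    proof (intro equalityI subsetI)
      fix e assume "e \<in> (`) \<sigma> ` edges G"
      then obtain e' where e': "e' \<in> edges G" "e = \<sigma> ` e'" by blast
      then have "e' \<subseteq> verts G" "card e' = 2" using G by (auto simp: simple_graph_def)
      then obtain a b where "e' = {a, b}" "a \<in> verts G" "b \<in> verts G" by (auto simp: card_2_iff)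
      then show "e \<in> edges H" using e' f(2) by (auto simp: \<sigma>_def)
    next
      fix e assume e: "e \<in> edges H"
      then have "e \<subseteq> \<sigma> ` verts G" "card e = 2" using H v by (auto simp: simple_graph_def)
      then obtain a b where ab: "e = {\<sigma> a, \<sigma> b}" "a \<in> verts G" "b \<in> verts G" by (auto simp: card_2_iff)
      then have "{a, b} \<in> edges G" using e f(2)[of a b] by (simp add: \<sigma>_def)
      then show "e \<in> (`) \<sigma> ` edges G" using ab by (intro image_eqI[of _ _ "{a, b}"]) auto
    qed
    then show ?thesis using v by (simp add: relabel_def)
  qed
  ultimately show ?thesis by blast
qed

text \<open>The permutation is independent of the tree, so it may be drawn first; for a fixed
  permutation the output law is that of Wilson's algorithm relabelled.\<close>

lemma seeded_tree_output_eq: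
  "seeded_tree_output n \<tau> = bind_spmf (spmf_of_set {\<pi>. \<pi> permutes {1..n}})
     (\<lambda>\<pi>. map_spmf (relabel \<pi>) (map_spmf fst (wilson (complete_graph n) \<tau>)))"
proof -
  have "seeded_tree_output n \<tau> = bind_spmf (wilson (complete_graph n) \<tau>)
      (\<lambda>r. bind_spmf (spmf_of_set {\<pi>. \<pi> permutes {1..n}}) (\<lambda>\<pi>. return_spmf (relabel \<pi> (fst r))))"
    by (simp add: seeded_tree_output_def seeded_tree_def map_spmf_bind_spmf o_def case_prod_beta)
  also have "\<dots> = bind_spmf (spmf_of_set {\<pi>. \<pi> permutes {1..n}})
      (\<lambda>\<pi>. bind_spmf (wilson (complete_graph n) \<tau>) (\<lambda>r. return_spmf (relabel \<pi> (fst r))))"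
    by (rule bind_commute_spmf)
  finally show ?thesis by (simp add: map_spmf_conv_bind_spmf)
qed

text \<open>Sort the permutations by the image of \<open>\<tau>\<close>. The images inside
  \<open>t\<close> are the copies of \<open>\<tau>\<close>, and each class has the size of the
  stabiliser of \<open>\<tau>\<close>.\<close>

lemma card_relabel_into:
  assumes \<tau>: "subtree \<tau> (complete_graph n)" and t: "spanning_tree t (complete_graph n)"
  shows "card {\<pi>. \<pi> permutes {1..n} \<and> subgraph (relabel \<pi> \<tau>) t} =
    card {s. subtree s t \<and> isomorphic s \<tau>} * card {\<pi>. \<pi> permutes {1..n} \<and> relabel \<pi> \<tau> = \<tau>}"
proof -
  let ?S = "{s. subtree s t \<and> isomorphic s \<tau>}"
  let ?F = "\<lambda>s. {\<pi>. \<pi> permutes {1..n} \<and> relabel \<pi> \<tau> = s}"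
  have \<tau>': "is_tree \<tau>" "simple_graph \<tau>" "verts \<tau> \<subseteq> {1..n}"
    using \<tau> by (auto simp: subtree_complete_graph_iff is_tree_def)
  have fin: "finite (?F s)" for s by (rule finite_subset[OF _ finite_permutations[of "{1..n}"]]) auto
  have ex: "\<exists>\<sigma>. \<sigma> permutes {1..n} \<and> relabel \<sigma> s = \<tau>" if "s \<in> ?S" for s
    using that \<tau>' t
    by (intro isomorphic_imp_relabel) (auto simp: subtree_def is_tree_def spanning_tree_def subgraph_def)
  have "?S \<subseteq> (\<lambda>\<pi>. relabel \<pi> \<tau>) ` {\<pi>. \<pi> permutes {1..n}}"
  proof
    fix s assume "s \<in> ?S"
    then obtain \<sigma> where \<sigma>: "\<sigma> permutes {1..n}" "relabel \<sigma> s = \<tau>" using ex by blast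
    then have "s = relabel (inv \<sigma>) \<tau>" using relabel_inv[OF \<sigma>(1)] by metis
    then show "s \<in> (\<lambda>\<pi>. relabel \<pi> \<tau>) ` {\<pi>. \<pi> permutes {1..n}}" using permutes_inv[OF \<sigma>(1)] by blast
  qed
  then have finS: "finite ?S" using finite_permutations[of "{1..n}"] by (meson finite_atLeastAtMost finite_imageI finite_subset)
  have card: "card (?F s) = card (?F \<tau>)" if s: "s \<in> ?S" for s
  proof -
    obtain \<sigma> where \<sigma>: "\<sigma> permutes {1..n}" "relabel \<sigma> s = \<tau>" using ex[OF s] by blast
    have s': "relabel (inv \<sigma>) \<tau> = s" using relabel_inv[OF \<sigma>(1)] \<sigma>(2) by metis
    \<comment> \<open>\<open>\<sigma>\<close> carries \<open>s\<close> back to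
      \<open>\<tau>\<close>, so composing with it turns a permutation onto \<open>s\<close> into one
      fixing \<open>\<tau>\<close>.\<close>
    have "bij_betw (\<lambda>\<pi>. \<sigma> \<circ> \<pi>) (?F s) (?F \<tau>)"
      using \<sigma> s' permutes_inv[OF \<sigma>(1)] permutes_inv_o[OF \<sigma>(1)]
      by (intro bij_betw_byWitness[where f' = "\<lambda>\<pi>. inv \<sigma> \<circ> \<pi>"])
         (auto simp: permutes_compose simp flip: relabel_comp comp_assoc)
    then show ?thesis by (rule bij_betw_same_card)
  qed
  have "{\<pi>. \<pi> permutes {1..n} \<and> subgraph (relabel \<pi> \<tau>) t} = (\<Union>s\<in>?S. ?F s)"
    using is_tree_relabel[OF permutes_inj \<tau>'(1)] isomorphic_relabel[of _ _ \<tau>]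
    by (auto simp: subtree_def)
  then have "card {\<pi>. \<pi> permutes {1..n} \<and> subgraph (relabel \<pi> \<tau>) t} = (\<Sum>s\<in>?S. card (?F s))"
    using fin finS by (simp only:) (subst card_UN_disjoint; auto)
  also have "\<dots> = (\<Sum>s\<in>?S. card (?F \<tau>))" using card by (intro sum.cong) auto
  finally show ?thesis by simp
qed

text \<open>For fixed \<open>\<pi>\<close> the output is \<open>t\<close> iff Wilson's tree is
  \<open>relabel (inv \<pi>) t\<close>, and this contains \<open>\<tau>\<close> iff
  \<open>relabel \<pi> \<tau>\<close> lies in \<open>t\<close>. Averaging over \<open>\<pi>\<close>
  counts such permutations.\<close>

lemma spmf_seeded_tree_output:
  assumes \<tau>: "subtree \<tau> (complete_graph n)" and t: "spanning_tree t (complete_graph n)"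
  shows "spmf (seeded_tree_output n \<tau>) t =
    n / (card (verts \<tau>) * n ^ (n - card (verts \<tau>))) *
    card {\<pi>. \<pi> permutes {1..n} \<and> relabel \<pi> \<tau> = \<tau>} / fact n *
    card {s. subtree s t \<and> isomorphic s \<tau>}"
proof -
  let ?P = "{\<pi>. \<pi> permutes {1..n}}"
  define C where "C = n / (card (verts \<tau>) * n ^ (n - card (verts \<tau>)))"
  let ?W = "map_spmf fst (wilson (complete_graph n) \<tau>)"
  have finP: "finite ?P" by (rule finite_permutations) simp
  have "spmf (map_spmf (relabel \<pi>) ?W) t = (if subgraph (relabel \<pi> \<tau>) t then C else 0)"
    if \<pi>: "\<pi> \<in> ?P" for \<pi>
  proof -
    have p: "\<pi> permutes {1..n}" "inv \<pi> permutes {1..n}" using \<pi> permutes_inv by auto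
    have "inj (relabel \<pi> :: nat ugraph \<Rightarrow> _)" using relabel_inv(2)[OF p(1)] by (metis injI)
    from spmf_map_inj'[OF this, of ?W "relabel (inv \<pi>) t"]
    have "spmf (map_spmf (relabel \<pi>) ?W) t = spmf ?W (relabel (inv \<pi>) t)"
      by (simp add: relabel_inv[OF p(1)])
    moreover have "subgraph \<tau> (relabel (inv \<pi>) t) \<longleftrightarrow> subgraph (relabel \<pi> \<tau>) t"
      using subgraph_relabel[OF permutes_inj[OF p(1)], of \<tau> "relabel (inv \<pi>) t"]
        subgraph_relabel[OF permutes_inj[OF p(2)], of "relabel \<pi> \<tau>" t]
      by (auto simp: relabel_inv[OF p(1)])
    ultimately show ?thesis
      using spmf_wilson_loop[OF \<tau> spanning_tree_relabel[OF p(2) t]]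
      by (simp add: wilson_def C_def)
  qed
  then have "(\<Sum>\<pi>\<in>?P. spmf (map_spmf (relabel \<pi>) ?W) t) = (\<Sum>\<pi>\<in>?P. if subgraph (relabel \<pi> \<tau>) t then C else 0)"
    by (intro sum.cong) auto
  also have "\<dots> = C * card {\<pi>. \<pi> permutes {1..n} \<and> subgraph (relabel \<pi> \<tau>) t}"
    using finP by (simp add: sum.If_cases Collect_conj_eq[symmetric] Int_def)
  finally show ?thesis
    unfolding seeded_tree_output_eq spmf_bind integral_spmf_of_set card_relabel_into[OF \<tau> t] C_def[symmetric]
    by (simp add: card_permutations)
qed

lemma expected_time_seeded_tree:
  assumes n: "n > 0" and \<tau>: "subtree \<tau> (complete_graph n)"
  shows "expected_time (seeded_tree n \<tau>) \<le> ennreal (40 * real n)"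
proof -
  let ?P = "{\<pi>. \<pi> permutes {1..n}}"
  have P: "finite ?P" "?P \<noteq> {}" using finite_permutations[of "{1..n}"] permutes_id[of "{1..n}"] by blast+
  let ?M = "measure_spmf (wilson (complete_graph n) \<tau>)"
  have \<tau>': "is_tree \<tau>" "verts \<tau> \<subseteq> {1..n}" using \<tau> by (auto simp: subtree_complete_graph_iff)
  have "card (verts \<tau>) \<le> n" using card_mono[OF _ \<tau>'(2)] by simp
  moreover have "card (edges \<tau>) \<le> card (verts \<tau>)" using \<tau>'(1) by (rule card_edges_le_card_verts)
  ultimately have init: "n + card (verts \<tau>) + card (edges \<tau>) + 1 \<le> 3 * n + 1" by simp
  have "lossless_spmf (wilson (complete_graph n) \<tau>)"
    unfolding wilson_def by (rule lossless_wilson_loop[OF \<tau>])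
  then have "lossless_spmf (seeded_tree n \<tau>)"
    using P by (auto simp: seeded_tree_def)
  then have "expected_time (seeded_tree n \<tau>) =
      (\<integral>\<^sup>+ r. \<integral>\<^sup>+ \<pi>. of_nat (snd r + 2 * n + card (verts (fst r)) + card (edges (fst r)))
        \<partial>measure_spmf (spmf_of_set ?P) \<partial>?M)"
    by (simp add: expected_time_lossless seeded_tree_def nn_integral_bind_spmf case_prod_beta
        measure_spmf_return_spmf nn_integral_return)
  \<comment> \<open>\<open>4 * n\<close> covers \<open>2 * n\<close> for the permutation,
    \<open>n\<close> vertices and at most \<open>n\<close> edges.\<close>
  also have "\<dots> \<le> (\<integral>\<^sup>+ r. of_nat (snd r) + of_nat (4 * n) \<partial>?M)"
  proof (rule nn_integral_mono_AE, rule AE_measure_spmf_iff[THEN iffD2], rule ballI, rule nn_integral_measure_spmf_le)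
    fix r :: "nat ugraph \<times> nat"
    assume "r \<in> set_spmf (wilson (complete_graph n) \<tau>)"
    then have "spanning_tree (fst r) (complete_graph n)"
      using set_spmf_wilson_loop[OF \<tau>, of "fst r" "snd r"] by (simp add: wilson_def)
    then have "card (verts (fst r)) = n" "card (edges (fst r)) \<le> card (verts (fst r))"
      using card_edges_le_card_verts[of "fst r"] by (simp_all add: spanning_tree_def subtree_def)
    then have "snd r + 2 * n + card (verts (fst r)) + card (edges (fst r)) \<le> snd r + 4 * n" by simp
    then have "of_nat (snd r + 2 * n + card (verts (fst r)) + card (edges (fst r))) \<le> (of_nat (snd r + 4 * n) :: ennreal)"
      by (rule of_nat_mono)
    then show "of_nat (snd r + 2 * n + card (verts (fst r)) + card (edges (fst r))) \<le>
      (of_nat (snd r) + of_nat (4 * n) :: ennreal)" by simp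
  qed
  also have "\<dots> = (\<integral>\<^sup>+ r. of_nat (snd r) \<partial>?M) + (\<integral>\<^sup>+ r. of_nat (4 * n) \<partial>?M)"
    by (rule nn_integral_add) auto
  also have "\<dots> \<le> (of_nat (n + card (verts \<tau>) + card (edges \<tau>) + 1) + 16 * ennreal (time_pot n (card (verts \<tau>))))
      + of_nat (4 * n)"
    using nn_integral_wilson_loop_time[OF \<tau>, of "n + card (verts \<tau>) + card (edges \<tau>)"]
    by (intro add_mono nn_integral_measure_spmf_le[where f = "\<lambda>_. of_nat (4 * n)"]) (simp_all add: wilson_def)
  also have "\<dots> \<le> (of_nat (3 * n + 1) + 16 * ennreal (2 * real n)) + of_nat (4 * n)"
    using init time_pot_le[OF n] by (intro add_mono mult_left_mono ennreal_leI of_nat_mono) auto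
  also have "\<dots> = ennreal (real (3 * n + 1) + 16 * (2 * real n) + real (4 * n))"
    by (simp only: ennreal_of_nat_eq_real_of_nat ennreal_numeral[symmetric] flip: ennreal_plus ennreal_mult')
  \<comment> \<open>The sum is \<open>39 * n + 1\<close>.\<close>
  also have "\<dots> \<le> ennreal (40 * real n)" using n by (intro ennreal_leI) simp
  finally show ?thesis .
qed

theorem theorem4:
  shows
    "(\<forall>(n::nat) (\<tau>::nat ugraph). n > 0 \<and> subtree \<tau> (complete_graph n) \<longrightarrow>
        (\<forall>T\<in>set_spmf (seeded_tree_output n \<tau>). spanning_tree T (complete_graph n)) \<and>
        (\<exists>c::real. c > 0 \<and>
           (\<forall>t. spanning_tree t (complete_graph n) \<longrightarrow>
              spmf (seeded_tree_output n \<tau>) t =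
                c * real (card {s. subtree s t \<and> isomorphic s \<tau>})))) \<and>
     (\<exists>C::real. \<forall>(n::nat) (\<tau>::nat ugraph). n > 0 \<and> subtree \<tau> (complete_graph n) \<longrightarrow>
        expected_time (seeded_tree n \<tau>) \<le> ennreal (C * real n))"
proof (intro conjI allI impI)
  fix n :: nat and \<tau> :: "nat ugraph"
  assume "n > 0 \<and> subtree \<tau> (complete_graph n)"
  then have n: "n > 0" and \<tau>: "subtree \<tau> (complete_graph n)" by auto
  show "\<forall>T\<in>set_spmf (seeded_tree_output n \<tau>). spanning_tree T (complete_graph n)"
    using set_spmf_wilson_loop[OF \<tau>] spanning_tree_relabel finite_permutations[of "{1..n}"]
    by (auto simp: seeded_tree_output_eq set_bind_spmf wilson_def)
  let ?Q = "{\<pi>. \<pi> permutes {1..n} \<and> relabel \<pi> \<tau> = \<tau>}"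
  have "finite ?Q" by (rule finite_subset[OF _ finite_permutations[of "{1..n}"]]) auto
  \<comment> \<open>The identity fixes \<open>\<tau>\<close>, so the stabiliser is nonempty and the
    constant positive.\<close>
  moreover have "id \<in> ?Q" by (simp add: permutes_id)
  ultimately have "card ?Q > 0" by (metis card_gt_0_iff empty_iff)
  then have "n / (card (verts \<tau>) * n ^ (n - card (verts \<tau>))) * card ?Q / fact n > 0"
    using n subtree_start(4)[OF \<tau>] by simp
  then show "\<exists>c::real. c > 0 \<and> (\<forall>t. spanning_tree t (complete_graph n) \<longrightarrow>
      spmf (seeded_tree_output n \<tau>) t = c * real (card {s. subtree s t \<and> isomorphic s \<tau>}))"
    using spmf_seeded_tree_output[OF \<tau>] by (intro exI conjI) auto
next
  show "\<exists>C::real. \<forall>(n::nat) (\<tau>::nat ugraph). n > 0 \<and> subtree \<tau> (complete_graph n) \<longrightarrow>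
      expected_time (seeded_tree n \<tau>) \<le> ennreal (C * real n)"
    using expected_time_seeded_tree by blast
qed

end
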